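(* Let $B_R\subset\mathbb{R}^n$ ($n\ge 2$) be the open ball of radius $R$ centered at the origin, let $d(x)=R-|x|$ be the distance from $x\in B_R$ to $\partial B_R$, let $X(t):=(1-\log t)^{-1}$ for $t\in(0,1]$, and let $[s]$ denote the integer part of $s$. (1) For all $u\in C_c^\infty(B_R)$, all $s\ge 2$ and all $\gamma>1$, $$\int_{B_R}\frac{|\nabla u|}{d^{s-1}}dx\ \ge\ (s-1)\int_{B_R}\frac{|u|}{d^s}dx+\sum_{k=1}^{[s]-1}\frac{n-1}{R^k}\int_{B_R}\frac{|u|}{d^{s-k}}dx+\frac{C}{R^{s-1}}\int_{B_R}\frac{|u|}{d}X^\gamma\Big(\frac dR\Big)dx,$$ where $C\ge\gamma-1$. The exponents $s-k$ ($k=1,\dots,[s]-1$) on the distance function and the constants $(n-1)/R^k$ ($k=1,\dots,[s]-1$) in the summation terms are optimal, in the following sense: setting $I_0[u]:=\int_{B_R}\frac{|\nabla u|}{d^{s-1}}dx-(s-1)\int_{B_R}\frac{|u|}{d^s}dx$ and $I_m[u]:=I_0[u]-\sum_{k=1}^m\frac{n-1}{R^k}\int_{B_R}\frac{|u|}{d^{s-k}}dx$ for $m=1,\dots,[s]-1$, one has for every $s\ge2$ and every $m\in\{0,\dots,[s]-2\}$ $$\inf_{u\in C_c^\infty(B_R)\setminus\{0\}}\frac{I_m[u]}{\int_{B_R}\frac{|u|}{d^\beta}dx}=\begin{cases}(n-1)/R^{m+1},&\beta=s-m-1,\\ 0,&\beta>s-m-1.\end{cases}$$ If $\gamma=1$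 the inequality fails, in the sense that $$\inf_{u\in C_c^\infty(B_R)\setminus\{0\}}\frac{I_{[s]-1}[u]}{\int_{B_R}\frac{|u|}{d}X(d/R)dx}=0.$$ (2) For all $u\in C_c^\infty(B_R)$, all $1\le s<2$ and all $\gamma>1$, $$\int_{B_R}\frac{|\nabla u|}{d^{s-1}}dx\ \ge\ (s-1)\int_{B_R}\frac{|u|}{d^s}dx+\frac{C}{R^{s-1}}\int_{B_R}\frac{|u|}{d}X^\gamma\Big(\frac dR\Big)dx,$$ where $C\ge\gamma-1$. If $\gamma=1$ this inequality fails in the sense that $\inf_{u\in C_c^\infty(B_R)\setminus\{0\}} I_0[u]\big/\int_{B_R}\frac{|u|}{d}X(d/R)dx=0$ (here $[s]-1=0$, so $I_{[s]-1}=I_0$).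
   Context: $B_R$ is a ball of radius $R$ centered at the origin in $\mathbb{R}^n$, $d(x)=R-|x|$, so that $-\Delta d(x)=\frac{n-1}{R-d(x)}$ for $x\in B_R\setminus\{0\}$. $X(t)=(1-\log t)^{-1}$ on $(0,1]$. *)

theory Defs
  imports "HOL-Analysis.Analysis"
begin

definition grad :: "('a::euclidean_space \<Rightarrow> real) \<Rightarrow> 'a \<Rightarrow> 'a" where
  "grad u x = (\<Sum>b\<in>Basis. frechet_derivative u (at x) b *\<^sub>R b)"

fun Ck_on :: "nat \<Rightarrow> 'a::euclidean_space set \<Rightarrow> ('a \<Rightarrow> real) \<Rightarrow> bool" where
  "Ck_on 0 S f = continuous_on S f"
| "Ck_on (Suc k) S f =
     ((\<forall>x\<in>S. f differentiable (at x)) \<and>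
      (\<forall>b\<in>Basis. Ck_on k S (\<lambda>x. frechet_derivative f (at x) b)))"

definition Cc_infty :: "real \<Rightarrow> ('a::euclidean_space \<Rightarrow> real) \<Rightarrow> bool" where
  "Cc_infty R u \<longleftrightarrow> (\<forall>k. Ck_on k (ball 0 R) u) \<and>
     (\<exists>K. compact K \<and> K \<subseteq> ball 0 R \<and> (\<forall>x. x \<notin> K \<longrightarrow> u x = 0))"

definition dB :: "real \<Rightarrow> 'a::euclidean_space \<Rightarrow> real" where
  "dB R x = R - norm x"

definition Xf :: "real \<Rightarrow> real" where
  "Xf t = 1 / (1 - ln t)"

definition I0 :: "real \<Rightarrow> real \<Rightarrow> ('a::euclidean_space \<Rightarrow> real) \<Rightarrow> real" where
  "I0 R s u = integral (ball 0 R) (\<lambda>x. norm (grad u x) / dB R x powr (s - 1))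
              - (s - 1) * integral (ball 0 R) (\<lambda>x. \<bar>u x\<bar> / dB R x powr s)"

definition Im :: "real \<Rightarrow> real \<Rightarrow> nat \<Rightarrow> ('a::euclidean_space \<Rightarrow> real) \<Rightarrow> real" where
  "Im R s m u = I0 R s u
     - (\<Sum>k=1..m. (real DIM('a) - 1) / R ^ k
                  * integral (ball 0 R) (\<lambda>x. \<bar>u x\<bar> / dB R x powr (s - real k)))"

end

theory Submission
  imports Defs "HOL-Real_Asymp.Real_Asymp"
begin

text \<open>For a radial vector field of size \<open>f (r)\<close> with \<open>f (0) = 0\<close> and \<open>0 \<le> f \<le> d powr (1 - s)\<close>, the
  divergence theorem bounds the gradient integral from below by the integral of
  \<open>\<bar>u\<bar> (f' + (n - 1) f / r)\<close>. With \<open>f = d powr (1 - s) - R powr (1 - s) X powr (\<gamma> - 1)\<close> the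
  derivative yields the Hardy term and the logarithmic term with constant \<open>\<gamma> - 1\<close>, and expanding
  \<open>(d powr (1 - s) - R powr (1 - s)) / (R - d)\<close> as a geometric sum yields the intermediate terms.
  The estimate is an equality, up to a bounded error, on nonnegative radially decreasing functions.
  Along smooth such functions increasing to the indicator function of the ball all the weights
  \<open>d powr (- \<beta>)\<close> with \<open>\<beta> \<ge> 1\<close> and \<open>X / d\<close> have integrals tending to infinity, so that only the
  boundary behaviour of the weights matters, and this gives the infima.\<close>

section \<open>Compactly supported functions and radial weights\<close>

text \<open>One exact identity serves both directions. For \<open>\<gamma> = 1\<close> the field has
  size \<open>d powr (1 - s) - R powr (1 - s)\<close>, and its divergence minus the Hardy weight and
  the first \<open>m\<close> intermediate weights is exactly n - 1 times a remainder of order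
  \<open>d powr (m + 1 - s)\<close>. The remainder is nonnegative if \<open>m + 1 \<le> s\<close>;
  this gives the inequality and the range of \<open>m\<close>. Its growth at the sphere, compared
  with the weight in the denominator, gives the infima: relative to
  \<open>d powr (m + 1 - s)\<close> its limit is (n - 1) / R^(m + 1), relative to a stronger power,
  or to X / d when \<open>s < m + 2\<close>, the limit is 0. The obstacle on the sharp side is the
  subtracted constant \<open>R powr (1 - s)\<close>, which costs that constant times the integral of
  the gradient. The cost is harmless because this integral stays bounded along the test functions
  while the denominators diverge, so that no rate of divergence has to be computed. Divergence is
  proved for X / d only, since every other weight in a denominator dominates a multiple of
  it.\<close>

lemma Cc_infty_support:
  fixes u :: "'a::euclidean_space \<Rightarrow> real"
  assumes "Cc_infty R u" "R > 0"
  obtains \<rho> where "0 < \<rho>" "\<rho> < R" "\<And>x. \<rho> < norm x \<Longrightarrow> u x = 0"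
proof -
  obtain K where K: "compact K" "K \<subseteq> ball 0 R" "\<And>x. x \<notin> K \<Longrightarrow> u x = 0"
    using assms(1) unfolding Cc_infty_def by blast
  show ?thesis
  proof (cases "K = {}")
    case True
    then show ?thesis using that[of "R/2"] K assms(2) by auto
  next
    case False
    obtain z where z: "z \<in> K" "\<And>y. y \<in> K \<Longrightarrow> norm y \<le> norm z"
      using continuous_attains_sup[OF K(1) False, of norm] by (auto intro: continuous_intros)
    have "norm z < R" using z(1) K(2) by auto
    show ?thesis
    proof (rule that[of "max (R/2) (norm z)"])
      fix x :: 'a assume "max (R/2) (norm z) < norm x"
      then show "u x = 0" using z(2)[of x] K(3)[of x] by force
    qed (use \<open>norm z < R\<close> assms(2) in auto)
  qed
qed

lemma inner_grad:
  assumes "u differentiable (at x)"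
  shows "grad u x \<bullet> h = frechet_derivative u (at x) h"
proof -
  have lin: "linear (frechet_derivative u (at x))"
    using assms linear_frechet_derivative by blast
  have "frechet_derivative u (at x) h = (\<Sum>b\<in>Basis. (h \<bullet> b) *\<^sub>R frechet_derivative u (at x) b)"
    by (subst euclidean_representation[of h, symmetric]) (simp only: linear_sum[OF lin] linear_scale[OF lin])
  then show ?thesis
    unfolding grad_def inner_sum_left by (auto intro!: sum.cong simp: inner_commute)
qed

lemma grad_eqI:
  assumes "(u has_derivative (\<lambda>h. v \<bullet> h)) (at x)"
  shows "grad u x = v"
proof -
  have "frechet_derivative u (at x) = (\<lambda>h. v \<bullet> h)"
    using assms frechet_derivative_at by metis
  then show ?thesis by (simp add: grad_def euclidean_representation)
qed

text \<open>Smoothness is assumed only in the open ball, but \<open>u\<close> vanishes beyond a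
  radius \<open>\<rho> < R\<close>. Hence it is continuously differentiable on the whole space, and
  the sphere never needs separate treatment.\<close>

lemma Cc_inftyE:
  fixes u :: "'a::euclidean_space \<Rightarrow> real"
  assumes "Cc_infty R u" "R > 0"
  obtains \<rho> L where "0 < \<rho>" "\<rho> < R" "\<And>x. (u has_derivative (\<lambda>h. grad u x \<bullet> h)) (at x)"
    "\<And>x. \<rho> < norm x \<Longrightarrow> u x = 0" "\<And>x. \<rho> < norm x \<Longrightarrow> grad u x = 0"
    "continuous_on UNIV (grad u)" "\<And>x. norm (grad u x) \<le> L"
proof -
  obtain \<rho> where \<rho>: "0 < \<rho>" "\<rho> < R" "\<And>x. \<rho> < norm x \<Longrightarrow> u x = 0"
    using Cc_infty_support[OF assms] by blast
  have C1: "Ck_on (Suc 0) (ball 0 R) u" using assms(1) unfolding Cc_infty_def by blast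
  have out: "(u has_derivative (\<lambda>h. 0 \<bullet> h)) (at x)" if "\<rho> < norm x" for x
  proof -
    have "((\<lambda>_. 0) has_derivative (\<lambda>h. 0 \<bullet> h)) (at x)" by simp
    then show ?thesis
      by (rule has_derivative_transform_within_open[of _ _ _ _ "- cball 0 \<rho>"]) (use \<rho>(3) that in auto)
  qed
  have g0: "grad u x = 0" if "\<rho> < norm x" for x using out[OF that] by (rule grad_eqI)
  have dif: "u differentiable (at x)" for x
  proof (cases "norm x < R")
    case True then show ?thesis using C1 by auto
  next
    case False then show ?thesis using out[of x] \<rho>(2) by (auto simp: differentiable_def)
  qed
  have der: "(u has_derivative (\<lambda>h. grad u x \<bullet> h)) (at x)" for x
    using dif[of x] by (simp add: inner_grad[OF dif] frechet_derivative_works[symmetric])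
  have "continuous_on (ball 0 R) (grad u)"
    unfolding grad_def using C1 by (intro continuous_intros) auto
  moreover have "continuous_on (- cball 0 \<rho>) (grad u)"
    by (rule continuous_on_eq[of _ "\<lambda>_. 0"]) (use g0 in auto)
  ultimately have "continuous_on (ball 0 R \<union> - cball 0 \<rho>) (grad u)"
    by (intro continuous_on_open_Un) auto
  moreover have "ball 0 R \<union> - cball 0 \<rho> = (UNIV :: 'a set)" using \<rho>(2) by auto
  ultimately have cont: "continuous_on UNIV (grad u)" by simp
  have "compact (grad u ` cball 0 \<rho>)"
    by (intro compact_continuous_image continuous_on_subset[OF cont]) auto
  then obtain L where L: "\<And>x. x \<in> cball 0 \<rho> \<Longrightarrow> norm (grad u x) \<le> L"
    using compact_imp_bounded bounded_iff by (metis image_eqI)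
  have "norm (grad u x) \<le> max 0 L" for x
    using L[of x] g0[of x] by (cases "norm x \<le> \<rho>") auto
  then show ?thesis using that[OF \<rho>(1,2) der \<rho>(3) g0 cont] by blast
qed

lemma Cc_infty_continuous:
  fixes u :: "'a::euclidean_space \<Rightarrow> real"
  assumes "Cc_infty R u" "R > 0"
  shows "continuous_on UNIV u"
proof -
  have "(u has_derivative (\<lambda>h. grad u x \<bullet> h)) (at x)" for x
    by (rule Cc_inftyE[OF assms])
  then show ?thesis
    by (meson continuous_at_imp_continuous_on has_derivative_continuous)
qed

section \<open>Integrability of compactly supported functions against radial weights\<close>

lemma integrable_bounded_support:
  fixes F :: "'a::euclidean_space \<Rightarrow> real"
  assumes "F \<in> borel_measurable borel" "\<And>x. \<rho> < norm x \<Longrightarrow> F x = 0"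
    "\<And>x. norm x \<le> \<rho> \<Longrightarrow> \<bar>F x\<bar> \<le> M"
  shows "integrable lborel F"
proof (rule Bochner_Integration.integrable_bound)
  show "integrable lborel (\<lambda>x::'a. indicat_real (cball 0 \<rho>) x *\<^sub>R M)"
    by (intro integrable_indicator) (use emeasure_bounded_finite[OF bounded_cball, of "0::'a" \<rho>] in \<open>simp_all add: infinity_ennreal_def\<close>)
  show "F \<in> borel_measurable lborel" using assms(1) by simp
  show "AE x in lborel. norm (F x) \<le> norm (indicat_real (cball 0 \<rho>) x *\<^sub>R M)"
  proof (rule AE_I2)
    fix x :: 'a
    show "norm (F x) \<le> norm (indicat_real (cball 0 \<rho>) x *\<^sub>R M)"
      using assms(2)[of x] assms(3)[of x] by (auto simp: indicator_def)
  qed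
qed

text \<open>Passes from the gauge integrals over the ball in the theorem to Lebesgue integrals over
  the whole space, where dilations and dominated convergence are applied.\<close>

lemma integral_ball_eq_lborel:
  fixes F :: "'a::euclidean_space \<Rightarrow> real"
  assumes "integrable lborel F" "\<And>x. R \<le> norm x \<Longrightarrow> F x = 0"
  shows "integral (ball 0 R) F = (LINT x|lborel. F x)"
proof -
  have "integral (ball 0 R) F = integral UNIV (\<lambda>x. if x \<in> ball 0 R then F x else 0)"
    by (rule integral_restrict_UNIV[symmetric])
  also have "(\<lambda>x. if x \<in> ball 0 R then F x else 0) = F" using assms(2) by (auto simp: fun_eq_iff)
  finally show ?thesis using assms(1) by (simp add: integral_lborel)
qed

text \<open>The weights may blow up only at the sphere, where test functions vanish. Boundedness is
  asked instead of continuity because a quotient \<open>f r / r\<close> takes the value 0 at the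
  origin by convention and so may jump there.\<close>

definition loc_bounded :: "real \<Rightarrow> (real \<Rightarrow> real) \<Rightarrow> bool" where
  "loc_bounded R k \<longleftrightarrow> k \<in> borel_measurable borel \<and>
     (\<forall>\<rho><R. \<exists>M. \<forall>r. 0 \<le> r \<longrightarrow> r \<le> \<rho> \<longrightarrow> \<bar>k r\<bar> \<le> M)"

lemma loc_bounded_continuous:
  assumes "k \<in> borel_measurable borel" "continuous_on {0..<R} k"
  shows "loc_bounded R k"
  unfolding loc_bounded_def
proof (intro conjI allI impI)
  fix \<rho> assume "\<rho> < R"
  then have "continuous_on {0..\<rho>} k" by (intro continuous_on_subset[OF assms(2)]) auto
  then have "bounded (k ` {0..\<rho>})" by (intro compact_imp_bounded compact_continuous_image) auto
  then show "\<exists>M. \<forall>r. 0 \<le> r \<longrightarrow> r \<le> \<rho> \<longrightarrow> \<bar>k r\<bar> \<le> M"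
    unfolding bounded_iff by (metis atLeastAtMost_iff image_eqI real_norm_def)
qed (use assms in auto)

lemma loc_bounded_add:
  assumes "loc_bounded R k" "loc_bounded R l"
  shows "loc_bounded R (\<lambda>r. k r + l r)"
  unfolding loc_bounded_def
proof (intro conjI allI impI)
  fix \<rho> assume "\<rho> < R"
  then obtain M M' where "\<forall>r. 0 \<le> r \<longrightarrow> r \<le> \<rho> \<longrightarrow> \<bar>k r\<bar> \<le> M" "\<forall>r. 0 \<le> r \<longrightarrow> r \<le> \<rho> \<longrightarrow> \<bar>l r\<bar> \<le> M'"
    using assms unfolding loc_bounded_def by blast
  then show "\<exists>M. \<forall>r. 0 \<le> r \<longrightarrow> r \<le> \<rho> \<longrightarrow> \<bar>k r + l r\<bar> \<le> M"
    by (intro exI[of _ "M + M'"]) (smt (verit))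
qed (use assms in \<open>auto simp: loc_bounded_def\<close>)

lemma loc_bounded_cmult:
  assumes "loc_bounded R k"
  shows "loc_bounded R (\<lambda>r. c * k r)"
  unfolding loc_bounded_def
proof (intro conjI allI impI)
  fix \<rho> assume "\<rho> < R"
  then obtain M where "\<forall>r. 0 \<le> r \<longrightarrow> r \<le> \<rho> \<longrightarrow> \<bar>k r\<bar> \<le> M"
    using assms unfolding loc_bounded_def by blast
  then show "\<exists>M. \<forall>r. 0 \<le> r \<longrightarrow> r \<le> \<rho> \<longrightarrow> \<bar>c * k r\<bar> \<le> M"
    by (intro exI[of _ "\<bar>c\<bar> * M"]) (auto simp: abs_mult intro!: mult_left_mono)
qed (use assms in \<open>auto simp: loc_bounded_def\<close>)

lemma integrable_radial_weight:
  fixes w :: "'a::euclidean_space \<Rightarrow> real"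
  assumes "loc_bounded R k" "\<rho> < R" "w \<in> borel_measurable borel"
    "\<And>x. \<rho> < norm x \<Longrightarrow> w x = 0" "\<And>x. \<bar>w x\<bar> \<le> B"
  shows "integrable lborel (\<lambda>x. w x * k (norm x))"
proof -
  obtain M where M: "\<forall>r. 0 \<le> r \<longrightarrow> r \<le> \<rho> \<longrightarrow> \<bar>k r\<bar> \<le> M"
    using assms(1,2) unfolding loc_bounded_def by blast
  have [measurable]: "k \<in> borel_measurable borel" "w \<in> borel_measurable borel"
    using assms unfolding loc_bounded_def by auto
  show ?thesis
  proof (rule integrable_bounded_support)
    fix x :: 'a assume "norm x \<le> \<rho>"
    then have "\<bar>k (norm x)\<bar> \<le> M" using M by auto
    then show "\<bar>w x * k (norm x)\<bar> \<le> B * M"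
      using assms(5)[of x] by (simp add: abs_mult mult_mono')
  qed (use assms in \<open>auto\<close>)
qed

lemma integral_dilation:
  fixes F :: "'a::euclidean_space \<Rightarrow> real"
  assumes "F \<in> borel_measurable borel" "c > 0"
  shows "(LINT x|lborel. c ^ DIM('a) * F (c *\<^sub>R x)) = (LINT x|lborel. F x)"
proof -
  have "(LINT x|lborel. F x) =
    (LINT x|density (distr lborel borel (\<lambda>x. 0 + c *\<^sub>R x)) (\<lambda>_. ennreal (\<bar>c\<bar> ^ DIM('a))). F x)"
    using assms(2) by (subst lborel_affine[of c 0]) auto
  also have "\<dots> = (LINT x|distr lborel borel (\<lambda>x. c *\<^sub>R x). c ^ DIM('a) * F x)"
    using assms by (subst integral_density) auto
  also have "\<dots> = (LINT x|lborel. c ^ DIM('a) * F (c *\<^sub>R x))"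
    using assms by (subst integral_distr) auto
  finally show ?thesis ..
qed

section \<open>The divergence theorem for radial fields\<close>

text \<open>The field \<open>g (norm x) x\<close> has divergence \<open>D (norm x)\<close>. Since \<open>w\<close> is only continuous, its radial
  derivative is replaced by the difference quotient along a dilation, and the integral of
  \<open>w (x) g (norm x)\<close> does not change when \<open>x\<close> is replaced by \<open>c x\<close> and multiplied by the Jacobian.\<close>

lemma dilation_divergence:
  fixes w :: "'a::euclidean_space \<Rightarrow> real"
  assumes \<rho>: "0 < \<rho>" "\<rho> < R" and w: "continuous_on UNIV w" "\<And>x. \<rho> < norm x \<Longrightarrow> w x = 0"
    and g: "loc_bounded R g" and D: "loc_bounded R D"
    and der: "\<And>r. 0 < r \<Longrightarrow> r < R \<Longrightarrow>
      ((\<lambda>r. r ^ DIM('a) * g r) has_real_derivative r ^ (DIM('a) - 1) * D r) (at r)"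
  shows "(\<lambda>k. LINT x|lborel. (w x - w ((1 + 1 / Suc k) *\<^sub>R x)) / (1 / Suc k) * g (norm x))
           \<longlonglongrightarrow> (LINT x|lborel. w x * D (norm x))"
proof -
  define n where "n = DIM('a)"
  define G where "G = (\<lambda>r. r ^ n * g r)"
  define e where "e = (\<lambda>k. 1 / real (Suc k))"
  define c where "c = (\<lambda>k. 1 + e k)"
  have n: "n \<ge> 1" unfolding n_def by (simp add: Suc_leI)
  have e: "0 < e k" "e k \<le> 1" for k unfolding e_def by auto
  have c: "1 < c k" "c k \<le> 2" for k unfolding c_def using e by auto
  have e0: "e \<longlonglongrightarrow> 0" unfolding e_def using LIMSEQ_inverse_real_of_nat by (simp add: inverse_eq_divide)
  have [measurable]: "w \<in> borel_measurable borel" "g \<in> borel_measurable borel" "D \<in> borel_measurable borel"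
    using w(1) g D borel_measurable_continuous_onI unfolding loc_bounded_def by auto
  have "compact (w ` cball 0 \<rho>)"
    by (intro compact_continuous_image continuous_on_subset[OF w(1)]) auto
  then obtain B' where B': "\<And>x. x \<in> cball 0 \<rho> \<Longrightarrow> norm (w x) \<le> B'"
    using compact_imp_bounded bounded_iff by (metis image_eqI)
  define B where "B = max 0 B'"
  have B: "\<bar>w x\<bar> \<le> B" for x
    using B'[of x] w(2)[of x] unfolding B_def by (cases "norm x \<le> \<rho>") auto
  obtain M' where M': "\<forall>r. 0 \<le> r \<longrightarrow> r \<le> \<rho> \<longrightarrow> \<bar>D r\<bar> \<le> M'"
    using D \<rho> unfolding loc_bounded_def by blast
  define M where "M = max 0 M'"
  have M: "\<bar>D r\<bar> \<le> M" "M \<ge> 0" if "0 \<le> r" "r \<le> \<rho>" for r using M' that unfolding M_def by force+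
  have wc0: "w (c k *\<^sub>R x) = 0" if "\<rho> < norm x" for k x
  proof -
    have "norm x \<le> c k * norm x" using c[of k] by (simp add: mult_le_cancel_right1)
    then show ?thesis using that c[of k] by (intro w(2)) auto
  qed
  \<comment> \<open>The dilation moves the difference quotient from \<open>w\<close> to
    \<open>g\<close>. Multiplied by \<open>r ^ (n - 1)\<close>, \<open>Q\<close> becomes the
    difference quotient of \<open>G\<close> with step \<open>e k * r\<close>, whose limit is given
    by \<open>derG\<close>.\<close>
  define Q where "Q = (\<lambda>k r. (c k ^ n * g (c k * r) - g r) / e k)"
  have QG: "r ^ (n - 1) * Q k r = (G (r + e k * r) - G r) / (e k * r)" if "r > 0" for k r
  proof -
    have "r ^ n = r ^ (n - 1) * r" using n by (metis Suc_diff_le diff_Suc_1 power_Suc2 le_add_diff_inverse plus_1_eq_Suc)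
    moreover have "r + e k * r = c k * r" by (simp add: c_def algebra_simps)
    ultimately show ?thesis using that e[of k] unfolding Q_def G_def
      by (simp add: power_mult_distrib field_simps)
  qed
  have derG: "(G has_real_derivative r ^ (n - 1) * D r) (at r)" if "0 < r" "r < R" for r
    using der[OF that] unfolding G_def n_def .
  have eq: "(LINT x|lborel. (w x - w (c k *\<^sub>R x)) / e k * g (norm x))
      = (LINT x|lborel. w (c k *\<^sub>R x) * Q k (norm x))" for k
  proof -
    define F where "F = (\<lambda>x. w x * g (norm x))"
    have i1: "integrable lborel F" unfolding F_def
      by (rule integrable_radial_weight[OF g \<rho>(2)]) (use w B in auto)
    have i2: "integrable lborel (\<lambda>x. w (c k *\<^sub>R x) * g (norm x))"
      by (rule integrable_radial_weight[OF g \<rho>(2)]) (use wc0 B in auto)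
    \<comment> \<open>The dilated weight is controlled only below radius \<open>R / c k\<close>, but
      the support of the dilated \<open>w\<close> shrinks by the same factor.\<close>
    have lb: "loc_bounded (R / c k) (\<lambda>r. g (c k * r))"
      unfolding loc_bounded_def
    proof (intro conjI allI impI)
      fix \<sigma> assume "\<sigma> < R / c k"
      then have "c k * \<sigma> < R" using c[of k] by (simp add: field_simps)
      then obtain N where N: "\<forall>r. 0 \<le> r \<longrightarrow> r \<le> c k * \<sigma> \<longrightarrow> \<bar>g r\<bar> \<le> N"
        using g unfolding loc_bounded_def by blast
      then show "\<exists>N. \<forall>r. 0 \<le> r \<longrightarrow> r \<le> \<sigma> \<longrightarrow> \<bar>g (c k * r)\<bar> \<le> N"
        using c[of k] by (intro exI[of _ N]) auto
    qed auto
    have "\<rho> / c k < R / c k" using \<rho> c[of k] by (simp add: divide_strict_right_mono)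
    moreover have "w (c k *\<^sub>R x) = 0" if "\<rho> / c k < norm x" for x
      by (rule w(2)) (use that c[of k] in \<open>simp add: field_simps\<close>)
    ultimately have "integrable lborel (\<lambda>x. w (c k *\<^sub>R x) * g (c k * norm x))"
      by (intro integrable_radial_weight[OF lb]) (use B in auto)
    moreover have Fc: "F (c k *\<^sub>R x) = w (c k *\<^sub>R x) * g (c k * norm x)" for x
      unfolding F_def using c[of k] by simp
    ultimately have i3: "integrable lborel (\<lambda>x. F (c k *\<^sub>R x))" by simp
    have [measurable]: "F \<in> borel_measurable borel" unfolding F_def by measurable
    have d: "(LINT x|lborel. c k ^ n * F (c k *\<^sub>R x)) = (LINT x|lborel. F x)"
      unfolding n_def using c[of k] by (intro integral_dilation) auto
    have "(LINT x|lborel. (w x - w (c k *\<^sub>R x)) / e k * g (norm x)) =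
      (LINT x|lborel. (F x - w (c k *\<^sub>R x) * g (norm x)) / e k)"
      by (rule Bochner_Integration.integral_cong) (auto simp: F_def algebra_simps diff_divide_distrib)
    also have "\<dots> = ((LINT x|lborel. F x) - (LINT x|lborel. w (c k *\<^sub>R x) * g (norm x))) / e k"
      using i1 i2 by simp
    also have "\<dots> = ((LINT x|lborel. c k ^ n * F (c k *\<^sub>R x)) - (LINT x|lborel. w (c k *\<^sub>R x) * g (norm x))) / e k"
      by (simp only: d)
    also have "\<dots> = (LINT x|lborel. (c k ^ n * F (c k *\<^sub>R x) - w (c k *\<^sub>R x) * g (norm x)) / e k)"
      using i3 i2 by simp
    also have "\<dots> = (LINT x|lborel. w (c k *\<^sub>R x) * Q k (norm x))"
      by (rule Bochner_Integration.integral_cong) (auto simp: Fc Q_def algebra_simps diff_divide_distrib)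
    finally show ?thesis .
  qed
  have "(\<lambda>k. LINT x|lborel. w (c k *\<^sub>R x) * Q k (norm x)) \<longlonglongrightarrow> (LINT x|lborel. w x * D (norm x))"
  proof (rule integral_dominated_convergence)
    show "integrable lborel (\<lambda>x::'a. indicat_real (cball 0 \<rho>) x *\<^sub>R (B * (2 ^ (n - 1) * M)))"
      by (intro integrable_indicator) (use emeasure_bounded_finite[OF bounded_cball, of "0::'a" \<rho>] in \<open>simp_all add: infinity_ennreal_def\<close>)
    have "AE x in lborel. x \<noteq> (0::'a)" by (rule AE_lborel_singleton)
    then show "AE x in lborel. (\<lambda>k. w (c k *\<^sub>R x) * Q k (norm x)) \<longlonglongrightarrow> w x * D (norm x)"
    proof eventually_elim
      case (elim x)
      show ?case
      proof (cases "norm x < R")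
        case False
        then show ?thesis using \<rho> w(2)[of x] wc0[of x] by simp
      next
        case True
        define r where "r = norm x"
        have r: "0 < r" "r < R" using elim True r_def by auto
        have "(\<lambda>k. c k *\<^sub>R x) \<longlonglongrightarrow> (1 + 0) *\<^sub>R x" unfolding c_def by (intro tendsto_intros e0)
        then have "(\<lambda>k. w (c k *\<^sub>R x)) \<longlonglongrightarrow> w x"
          using continuous_on_tendsto_compose[OF w(1)] by simp
        moreover have "(\<lambda>k. Q k r) \<longlonglongrightarrow> D r"
        proof -
          have "((\<lambda>h. (G (r + h) - G r) / h) \<longlongrightarrow> r ^ (n - 1) * D r) (at 0)"
            using derG[OF r] by (simp add: DERIV_def)
          moreover have "filterlim (\<lambda>k. e k * r) (at 0) sequentially"
            unfolding filterlim_at using e0 e r by (auto intro!: tendsto_mult_left_zero always_eventually simp: less_le)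
          ultimately have "(\<lambda>k. (G (r + e k * r) - G r) / (e k * r)) \<longlonglongrightarrow> r ^ (n - 1) * D r"
            by (rule filterlim_compose)
          then have "(\<lambda>k. r ^ (n - 1) * Q k r) \<longlonglongrightarrow> r ^ (n - 1) * D r"
            using QG[OF r(1)] by simp
          then show ?thesis using r(1) by (simp add: tendsto_mult_left_iff)
        qed
        ultimately show ?thesis unfolding r_def by (rule tendsto_mult)
      qed
    qed
    fix k
    from \<open>AE x in lborel. x \<noteq> (0::'a)\<close>
    show "AE x in lborel. norm (w (c k *\<^sub>R x) * Q k (norm x)) \<le> indicat_real (cball 0 \<rho>) x *\<^sub>R (B * (2 ^ (n - 1) * M))"
    proof eventually_elim
      case (elim x)
      define r where "r = norm x"
      have r: "0 < r" using elim r_def by auto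
      show ?case
      proof (cases "c k * r \<le> \<rho>")
        case False
        then have "w (c k *\<^sub>R x) = 0" using c[of k] by (intro w(2)) (auto simp: r_def)
        then show ?thesis using B[of 0] M(2)[of 0] \<rho> by (simp add: indicator_def)
      next
        case True
        have "r < c k * r" using c[of k] r by simp
        then have xr: "r \<le> \<rho>" using True by simp
        \<comment> \<open>Since \<open>c k \<le> 2\<close>, the intermediate point satisfies z \<le>
          2 r. The factor \<open>r ^ (n - 1)\<close> then cancels, and the bound on \<open>Q\<close>
          is uniform up to the origin.\<close>
        obtain z where z: "z > r" "z < c k * r" "G (c k * r) - G r = (c k * r - r) * (z ^ (n - 1) * D z)"
          using MVT2[OF \<open>r < c k * r\<close>, of G "\<lambda>z. z ^ (n - 1) * D z"] derG r \<rho>(2) True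
          by (metis le_less_trans less_le_trans order_less_le)
        have cr: "r + e k * r = c k * r" by (simp add: c_def algebra_simps)
        have "r ^ (n - 1) * Q k r = z ^ (n - 1) * D z"
          using z(3) QG[OF r, of k] r e[of k] unfolding cr by (simp add: c_def field_simps)
        then have "\<bar>r ^ (n - 1) * Q k r\<bar> = z ^ (n - 1) * \<bar>D z\<bar>" using z r by (simp add: abs_mult power_abs)
        also have "\<dots> \<le> (2 * r) ^ (n - 1) * M"
        proof (intro mult_mono power_mono)
          show "z \<le> 2 * r" using order_trans[OF less_imp_le[OF z(2)] mult_right_mono[of "c k" 2 r]] c[of k] r by simp
        qed (use z r M[of z] True in auto)
        finally have "r ^ (n - 1) * \<bar>Q k r\<bar> \<le> r ^ (n - 1) * (2 ^ (n - 1) * M)"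
          using r by (simp add: abs_mult power_mult_distrib power_abs algebra_simps)
        then have "\<bar>Q k r\<bar> \<le> 2 ^ (n - 1) * M" using r by simp
        then have "\<bar>w (c k *\<^sub>R x)\<bar> * \<bar>Q k r\<bar> \<le> B * (2 ^ (n - 1) * M)"
          using B[of "c k *\<^sub>R x"] by (intro mult_mono) (auto intro: order_trans[OF abs_ge_zero])
        then show ?thesis using xr by (simp add: abs_mult r_def)
      qed
    qed
  qed (auto simp: Q_def)
  then have "(\<lambda>k. LINT x|lborel. (w x - w (c k *\<^sub>R x)) / e k * g (norm x)) \<longlonglongrightarrow> (LINT x|lborel. w x * D (norm x))"
    by (simp only: eq)
  then show ?thesis unfolding c_def e_def .
qed

text \<open>By the mean value theorem the quotient is a value of \<open>f'\<close> at a smaller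
  radius, because \<open>f\<close> vanishes at the origin.\<close>

lemma loc_bounded_quotient:
  assumes "f 0 = 0" "\<And>r. 0 \<le> r \<Longrightarrow> r < R \<Longrightarrow> (f has_real_derivative f' r) (at r)"
    and "f \<in> borel_measurable borel" "loc_bounded R f'"
  shows "loc_bounded R (\<lambda>r. f r / r)"
  unfolding loc_bounded_def
proof (intro conjI allI impI)
  fix \<rho> assume "\<rho> < R"
  then obtain M where M: "\<forall>r. 0 \<le> r \<longrightarrow> r \<le> \<rho> \<longrightarrow> \<bar>f' r\<bar> \<le> M"
    using assms(4) unfolding loc_bounded_def by blast
  show "\<exists>M. \<forall>r. 0 \<le> r \<longrightarrow> r \<le> \<rho> \<longrightarrow> \<bar>f r / r\<bar> \<le> M"
  proof (intro exI[of _ "\<bar>M\<bar>"] allI impI)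
    fix r :: real assume r: "0 \<le> r" "r \<le> \<rho>"
    show "\<bar>f r / r\<bar> \<le> \<bar>M\<bar>"
    proof (cases "r = 0")
      case False
      then have "0 < r" using r by simp
      then obtain z where z: "0 < z" "z < r" "f r - f 0 = (r - 0) * f' z"
        using MVT2[of 0 r f f'] assms(2) r \<open>\<rho> < R\<close> by (metis le_less_trans less_imp_le)
      then have "f r / r = f' z" using assms(1) \<open>0 < r\<close> by simp
      then show ?thesis using M z r by (metis abs_ge_self less_imp_le order_trans)
    qed auto
  qed
qed (use assms(3) in auto)

text \<open>\<open>dilation_divergence\<close> is applied to \<bar>u\<bar> with
  \<open>g = f / r\<close>, so that the field has size \<open>f\<close> and divergence f' + (n - 1)
  f / r. For nonnegative radially decreasing \<open>u\<close> the difference quotients of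
  \<bar>u\<bar> and the absolute ones of \<open>u\<close> agree already before the limit, because
  \<open>c k > 1\<close> moves every point outward.\<close>

lemma radial_divergence:
  fixes u :: "'a::euclidean_space \<Rightarrow> real"
  assumes u: "Cc_infty R u" and R: "R > 0"
    and f: "f 0 = 0" "\<And>r. 0 \<le> r \<Longrightarrow> r < R \<Longrightarrow> (f has_real_derivative f' r) (at r)"
      "f \<in> borel_measurable borel" "loc_bounded R f'" "\<And>r. 0 \<le> r \<Longrightarrow> r < R \<Longrightarrow> 0 \<le> f r"
  shows "(LINT x|lborel. \<bar>u x\<bar> * (f' (norm x) + (real DIM('a) - 1) * (f (norm x) / norm x)))
          \<le> (LINT x|lborel. \<bar>grad u x \<bullet> x\<bar> * (f (norm x) / norm x))"
    and "(\<And>x y. norm x \<le> norm y \<Longrightarrow> 0 \<le> u y \<and> u y \<le> u x) \<Longrightarrow>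
         (LINT x|lborel. \<bar>u x\<bar> * (f' (norm x) + (real DIM('a) - 1) * (f (norm x) / norm x)))
          = (LINT x|lborel. \<bar>grad u x \<bullet> x\<bar> * (f (norm x) / norm x))"
proof -
  obtain \<rho> L where \<rho>: "0 < \<rho>" "\<rho> < R" and der: "\<And>x. (u has_derivative (\<lambda>h. grad u x \<bullet> h)) (at x)"
    and u0: "\<And>x. \<rho> < norm x \<Longrightarrow> u x = 0" and g0: "\<And>x. \<rho> < norm x \<Longrightarrow> grad u x = 0"
    and L: "\<And>x. norm (grad u x) \<le> L"
    by (rule Cc_inftyE[OF u R], blast)
  note cont = Cc_infty_continuous[OF u R]
  have [measurable]: "u \<in> borel_measurable borel" "f \<in> borel_measurable borel"
    using cont f(3) borel_measurable_continuous_onI by auto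
  define g where "g = (\<lambda>r. f r / r)"
  have g: "loc_bounded R g" unfolding g_def by (rule loc_bounded_quotient[OF f(1-4)])
  define D where "D = (\<lambda>r. f' r + (real DIM('a) - 1) * g r)"
  have D: "loc_bounded R D" unfolding D_def by (intro loc_bounded_add loc_bounded_cmult f g)
  have [measurable]: "g \<in> borel_measurable borel" unfolding g_def by measurable
  have gpos: "0 \<le> g r" if "0 \<le> r" "r < R" for r using f(5)[OF that] that by (simp add: g_def)
  define e where "e = (\<lambda>k. 1 / real (Suc k))"
  have e: "0 < e k" "e k \<le> 1" for k unfolding e_def by auto
  have e0: "e \<longlonglongrightarrow> 0" unfolding e_def using LIMSEQ_inverse_real_of_nat by (simp add: inverse_eq_divide)
  define c where "c = (\<lambda>k. 1 + e k)"
  have uc0: "u (c k *\<^sub>R x) = 0" if "\<rho> < norm x" for k x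
  proof -
    have "norm x \<le> c k * norm x" using e[of k] by (simp add: mult_le_cancel_right1 c_def)
    then show ?thesis using that e[of k] by (intro u0) (auto simp: c_def)
  qed
  have derD: "((\<lambda>r. r ^ DIM('a) * g r) has_real_derivative r ^ (DIM('a) - 1) * D r) (at r)" if r: "0 < r" "r < R" for r
  proof -
    define m where "m = DIM('a) - 1"
    have n: "DIM('a) = Suc m" using DIM_positive[where 'a='a] unfolding m_def by simp
    have "((\<lambda>r. r ^ m * f r) has_real_derivative real m * r ^ (m - 1) * f r + f' r * r ^ m) (at r)"
      using r by (auto intro!: derivative_eq_intros f(2))
    moreover have "real m * r ^ (m - 1) * f r + f' r * r ^ m = r ^ m * D r"
      using r unfolding D_def n g_def by (cases m) (auto simp: field_simps)
    ultimately have "((\<lambda>r. r ^ m * f r) has_real_derivative r ^ m * D r) (at r)" by simp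
    then have "((\<lambda>r. r ^ DIM('a) * g r) has_real_derivative r ^ m * D r) (at r)"
    proof (rule has_field_derivative_transform_within_open[of _ _ _ "{0<..}"])
      fix x :: real assume "x \<in> {0<..}"
      then show "x ^ m * f x = x ^ DIM('a) * g x" unfolding n g_def by simp
    qed (use r in auto)
    then show ?thesis by (simp add: m_def)
  qed
  have limL: "(\<lambda>k. LINT x|lborel. (\<bar>u x\<bar> - \<bar>u (c k *\<^sub>R x)\<bar>) / e k * g (norm x))
           \<longlonglongrightarrow> (LINT x|lborel. \<bar>u x\<bar> * D (norm x))"
    unfolding c_def e_def
    by (rule dilation_divergence[OF \<rho> _ _ g D derD]) (use cont u0 in \<open>auto intro!: continuous_intros\<close>)
  have lip: "\<bar>u x - u y\<bar> \<le> L * norm (x - y)" for x y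
  proof -
    have "norm (u x - u y) \<le> L * norm (x - y)"
    proof (rule differentiable_bound[of UNIV u "\<lambda>x h. grad u x \<bullet> h"])
      fix x
      show "onorm ((\<bullet>) (grad u x)) \<le> L"
        by (rule onorm_le) (metis Cauchy_Schwarz_ineq2 L mult_right_mono norm_ge_zero order_trans real_norm_def)
    qed (use der in auto)
    then show ?thesis by simp
  qed
  obtain N where N: "\<forall>r. 0 \<le> r \<longrightarrow> r \<le> \<rho> \<longrightarrow> \<bar>g r\<bar> \<le> N"
    using g \<rho> unfolding loc_bounded_def by blast
  have bnd: "\<bar>\<bar>u x - u (c k *\<^sub>R x)\<bar> / e k * g (norm x)\<bar> \<le> indicat_real (cball 0 \<rho>) x * (L * \<rho> * N)" for x k
  proof (cases "norm x \<le> \<rho>")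
    case False then show ?thesis using u0[of x] uc0[of x k] by simp
  next
    case True
    have "\<bar>u x - u (c k *\<^sub>R x)\<bar> \<le> L * norm (x - c k *\<^sub>R x)" by (rule lip)
    also have "x - c k *\<^sub>R x = - (e k *\<^sub>R x)" by (simp add: c_def algebra_simps)
    finally have "\<bar>u x - u (c k *\<^sub>R x)\<bar> / e k \<le> L * norm x" using e[of k] by (simp add: field_simps)
    also have "L * norm x \<le> L * \<rho>" using True L[of 0] norm_ge_zero order_trans mult_left_mono by metis
    finally have "\<bar>u x - u (c k *\<^sub>R x)\<bar> / e k * \<bar>g (norm x)\<bar> \<le> L * \<rho> * N"
      using N True e[of k] order_trans[OF norm_ge_zero L] \<rho> by (intro mult_mono) (auto intro!: mult_nonneg_nonneg)
    then show ?thesis using True e[of k] by (simp add: abs_mult)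
  qed
  have limR: "(\<lambda>k. LINT x|lborel. \<bar>u x - u (c k *\<^sub>R x)\<bar> / e k * g (norm x))
           \<longlonglongrightarrow> (LINT x|lborel. \<bar>grad u x \<bullet> x\<bar> * g (norm x))"
  proof (rule integral_dominated_convergence)
    show "integrable lborel (\<lambda>x::'a. indicat_real (cball 0 \<rho>) x * (L * \<rho> * N))"
      using emeasure_bounded_finite[OF bounded_cball, of "0::'a" \<rho>] by (simp add: infinity_ennreal_def)
    show "AE x in lborel. (\<lambda>k. \<bar>u x - u (c k *\<^sub>R x)\<bar> / e k * g (norm x)) \<longlonglongrightarrow> \<bar>grad u x \<bullet> x\<bar> * g (norm x)"
    proof (rule AE_I2)
      fix x
      have "((\<lambda>t. u (x + t *\<^sub>R x)) has_derivative (\<lambda>t. grad u x \<bullet> (t *\<^sub>R x))) (at 0)"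
      proof (rule has_derivative_compose[where g = u and f = "\<lambda>t. x + t *\<^sub>R x" and f' = "\<lambda>t. t *\<^sub>R x"])
        show "((\<lambda>t. x + t *\<^sub>R x) has_derivative (\<lambda>t. t *\<^sub>R x)) (at 0)"
          by (auto intro!: derivative_eq_intros)
      qed (use der in simp)
      then have "((\<lambda>t. u (x + t *\<^sub>R x)) has_real_derivative grad u x \<bullet> x) (at 0)"
        unfolding has_field_derivative_def by (rule has_derivative_eq_rhs) (auto simp: fun_eq_iff)
      then have "((\<lambda>h. (u (x + h *\<^sub>R x) - u x) / h) \<longlongrightarrow> grad u x \<bullet> x) (at 0)"
        by (simp add: DERIV_def)
      moreover have "filterlim e (at 0) sequentially"
        unfolding filterlim_at using e0 e by (auto intro!: always_eventually simp: less_le)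
      ultimately have "(\<lambda>k. (u (x + e k *\<^sub>R x) - u x) / e k) \<longlonglongrightarrow> grad u x \<bullet> x"
        by (rule filterlim_compose)
      then have "(\<lambda>k. \<bar>(u (x + e k *\<^sub>R x) - u x) / e k\<bar> * g (norm x)) \<longlonglongrightarrow> \<bar>grad u x \<bullet> x\<bar> * g (norm x)"
        by (intro tendsto_intros)
      moreover have "\<bar>(u (x + e k *\<^sub>R x) - u x) / e k\<bar> = \<bar>u x - u (c k *\<^sub>R x)\<bar> / e k" for k
        using e[of k] by (simp add: c_def algebra_simps abs_minus_commute)
      ultimately show "(\<lambda>k. \<bar>u x - u (c k *\<^sub>R x)\<bar> / e k * g (norm x)) \<longlonglongrightarrow> \<bar>grad u x \<bullet> x\<bar> * g (norm x)"
        by (simp only:)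
    qed
    show "AE x in lborel. norm (\<bar>u x - u (c k *\<^sub>R x)\<bar> / e k * g (norm x)) \<le> indicat_real (cball 0 \<rho>) x * (L * \<rho> * N)" for k
      using bnd by simp
    have "continuous_on UNIV (grad u)" by (rule Cc_inftyE[OF u R])
    then have [measurable]: "grad u \<in> borel_measurable borel" by (rule borel_measurable_continuous_onI)
    show "(\<lambda>x. \<bar>grad u x \<bullet> x\<bar> * g (norm x)) \<in> borel_measurable lborel" by measurable
  qed measurable
  have int: "integrable lborel (\<lambda>x. h x / e k * g (norm x))"
    if "\<And>x. \<bar>h x\<bar> \<le> \<bar>u x - u (c k *\<^sub>R x)\<bar>" "h \<in> borel_measurable borel" for h k
  proof (rule integrable_bounded_support[of _ \<rho> "L * \<rho> * N"])
    note [measurable] = that(2)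
    show "(\<lambda>x. h x / e k * g (norm x)) \<in> borel_measurable borel" by measurable
    fix x
    show "\<rho> < norm x \<Longrightarrow> h x / e k * g (norm x) = 0" using that(1)[of x] u0[of x] uc0[of x k] by simp
    have "\<bar>h x / e k * g (norm x)\<bar> \<le> \<bar>\<bar>u x - u (c k *\<^sub>R x)\<bar> / e k * g (norm x)\<bar>"
      using that(1)[of x] e[of k] by (auto simp: abs_mult intro!: mult_right_mono divide_right_mono)
    then show "norm x \<le> \<rho> \<Longrightarrow> \<bar>h x / e k * g (norm x)\<bar> \<le> L * \<rho> * N"
      using bnd[of x k] by simp
  qed
  \<comment> \<open>the triangle inequality for difference quotients avoids differentiating \<open>\<bar>u\<bar>\<close>\<close>
  have "(LINT x|lborel. (\<bar>u x\<bar> - \<bar>u (c k *\<^sub>R x)\<bar>) / e k * g (norm x))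
     \<le> (LINT x|lborel. \<bar>u x - u (c k *\<^sub>R x)\<bar> / e k * g (norm x))" for k
  proof (rule integral_mono[OF int int])
    fix x
    show "(\<bar>u x\<bar> - \<bar>u (c k *\<^sub>R x)\<bar>) / e k * g (norm x) \<le> \<bar>u x - u (c k *\<^sub>R x)\<bar> / e k * g (norm x)"
    proof (cases "norm x < R")
      case True
      then show ?thesis using gpos[of "norm x"] e[of k] by (intro mult_right_mono divide_right_mono) auto
    next
      case False
      then show ?thesis using \<rho> u0[of x] uc0[of x k] by simp
    qed
  qed auto
  then have le: "(LINT x|lborel. \<bar>u x\<bar> * D (norm x)) \<le> (LINT x|lborel. \<bar>grad u x \<bullet> x\<bar> * g (norm x))"
    by (intro LIMSEQ_le[OF limL limR]) auto
  show "(LINT x|lborel. \<bar>u x\<bar> * (f' (norm x) + (real DIM('a) - 1) * (f (norm x) / norm x)))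
          \<le> (LINT x|lborel. \<bar>grad u x \<bullet> x\<bar> * (f (norm x) / norm x))"
    using le unfolding D_def g_def .
  assume mono: "\<And>x y. norm x \<le> norm y \<Longrightarrow> 0 \<le> u y \<and> u y \<le> u x"
  have "\<bar>u x\<bar> - \<bar>u (c k *\<^sub>R x)\<bar> = \<bar>u x - u (c k *\<^sub>R x)\<bar>" for x k
  proof -
    have "norm x \<le> norm (c k *\<^sub>R x)" using e[of k] by (simp add: mult_le_cancel_right1 c_def)
    from mono[OF this] show ?thesis by simp
  qed
  then show "(LINT x|lborel. \<bar>u x\<bar> * (f' (norm x) + (real DIM('a) - 1) * (f (norm x) / norm x)))
          = (LINT x|lborel. \<bar>grad u x \<bullet> x\<bar> * (f (norm x) / norm x))"
    using LIMSEQ_unique[OF limL] limR unfolding D_def g_def by simp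
qed

section \<open>Smooth functions exhausting the ball\<close>

text \<open>For \<open>t > 0\<close> the \<open>n\<close>-th derivative of \<open>exp (- 1 / t)\<close> is \<open>P\<^sub>n (1 / t) * exp (- 1 / t)\<close> with
  \<open>P\<^sub>n\<^sub>+\<^sub>1 (y) = y\<^sup>2 (P\<^sub>n (y) - P\<^sub>n' (y))\<close>.\<close>

primrec flat_poly :: "nat \<Rightarrow> real poly" where
  "flat_poly 0 = 1"
| "flat_poly (Suc n) = pCons 0 (pCons 0 (flat_poly n - pderiv (flat_poly n)))"

definition flat :: "nat \<Rightarrow> real \<Rightarrow> real" where
  "flat n t = (if t > 0 then poly (flat_poly n) (1 / t) * exp (- (1 / t)) else 0)"

text \<open>The free exponent \<open>k\<close> carries the induction, since \<open>pCons\<close>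
  multiplies by \<open>y\<close>. The case k = 1, with y = 1 / h, is the difference quotient of
  \<open>flat\<close> at the origin.\<close>

lemma tendsto_poly_exp_minus:
  "((\<lambda>y. y ^ k * poly p y * exp (- y)) \<longlongrightarrow> (0::real)) at_top"
proof (induction p arbitrary: k)
  case (pCons a p)
  have "((\<lambda>y. a * (y ^ k / exp y) + y ^ Suc k * poly p y * exp (- y)) \<longlongrightarrow> a * 0 + 0) at_top"
    by (intro tendsto_intros tendsto_power_div_exp_0 pCons)
  then show ?case by (simp add: algebra_simps exp_minus divide_inverse)
qed simp

lemma flat_has_derivative: "(flat n has_real_derivative flat (Suc n) t) (at t)"
proof -
  consider "t > 0" | "t < 0" | "t = 0" by linarith
  then show ?thesis
  proof cases
    case 1
    have "((\<lambda>t. poly (flat_poly n) (1 / t) * exp (- (1 / t))) has_real_derivative flat (Suc n) t) (at t)"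
      using 1 by (auto intro!: derivative_eq_intros DERIV_chain2[OF poly_DERIV]
          simp: flat_def power2_eq_square field_simps)
    then show ?thesis
      by (rule has_field_derivative_transform_within_open[of _ _ _ "{0<..}"]) (use 1 in \<open>auto simp: flat_def\<close>)
  next
    case 2
    have "((\<lambda>_. 0) has_real_derivative flat (Suc n) t) (at t)" using 2 by (auto simp: flat_def)
    then show ?thesis
      by (rule has_field_derivative_transform_within_open[of _ _ _ "{..<0}"]) (use 2 in \<open>auto simp: flat_def\<close>)
  next
    case 3
    have "((\<lambda>h. inverse h ^ 1 * poly (flat_poly n) (inverse h) * exp (- inverse h)) \<longlongrightarrow> 0) (at_right 0)"
      by (rule filterlim_compose[OF tendsto_poly_exp_minus filterlim_inverse_at_top_right])
    moreover have "eventually (\<lambda>h. inverse h ^ 1 * poly (flat_poly n) (inverse h) * exp (- inverse h) = flat n h / h) (at_right 0)"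
      by (rule eventually_mono[OF eventually_at_right_less]) (auto simp: flat_def inverse_eq_divide)
    ultimately have "((\<lambda>h. flat n h / h) \<longlongrightarrow> 0) (at_right 0)"
      by (simp add: tendsto_cong)
    moreover have "((\<lambda>h. flat n h / h) \<longlongrightarrow> 0) (at_left 0)"
    proof (rule tendsto_eventually)
      show "eventually (\<lambda>h. flat n h / h = 0) (at_left 0)"
        unfolding eventually_at_left_field by (intro exI[of _ "-1"]) (auto simp: flat_def)
    qed
    ultimately have "((\<lambda>h. flat n h / h) \<longlongrightarrow> 0) (at 0)" by (simp add: filterlim_split_at)
    then show ?thesis using 3 by (simp add: DERIV_def flat_def)
  qed
qed

section \<open>Closure of smooth functions under sums, products and composition\<close>

lemma Ck_on_subset: "Ck_on k T f \<Longrightarrow> S \<subseteq> T \<Longrightarrow> Ck_on k S f"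
  by (induction k arbitrary: f) (auto intro: continuous_on_subset)

lemma Ck_on_Suc_imp: "Ck_on (Suc k) S f \<Longrightarrow> Ck_on k S f"
proof (induction k arbitrary: f)
  case 0
  then show ?case by (auto intro!: continuous_at_imp_continuous_on differentiable_imp_continuous_within)
qed auto

lemma Ck_on_const: "Ck_on k UNIV (\<lambda>_. c)"
proof (induction k arbitrary: c)
  case (Suc k)
  then show ?case by (simp add: frechet_derivative_const)
qed simp

lemma Ck_on_add: "Ck_on k UNIV f \<Longrightarrow> Ck_on k UNIV g \<Longrightarrow> Ck_on k UNIV (\<lambda>x. f x + g x)"
proof (induction k arbitrary: f g)
  case (Suc k)
  have "frechet_derivative (\<lambda>x. f x + g x) (at x) b =
      frechet_derivative f (at x) b + frechet_derivative g (at x) b" for x b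
  proof -
    have "((\<lambda>x. f x + g x) has_derivative (\<lambda>h. frechet_derivative f (at x) h + frechet_derivative g (at x) h)) (at x)"
      using Suc.prems by (intro has_derivative_add) (auto simp: frechet_derivative_works[symmetric])
    from fun_cong[OF frechet_derivative_at[OF this], of b] show ?thesis by simp
  qed
  with Suc show ?case by simp
qed (simp add: continuous_on_add)

lemma Ck_on_mult: "Ck_on k UNIV f \<Longrightarrow> Ck_on k UNIV g \<Longrightarrow> Ck_on k UNIV (\<lambda>x. f x * g x)"
proof (induction k arbitrary: f g)
  case (Suc k)
  have "frechet_derivative (\<lambda>x. f x * g x) (at x) b =
      f x * frechet_derivative g (at x) b + frechet_derivative f (at x) b * g x" for x b
  proof -
    have "((\<lambda>x. f x * g x) has_derivative (\<lambda>h. f x * frechet_derivative g (at x) h + frechet_derivative f (at x) h * g x)) (at x)"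
      using Suc.prems by (intro has_derivative_mult) (auto simp: frechet_derivative_works[symmetric])
    from fun_cong[OF frechet_derivative_at[OF this], of b] show ?thesis by simp
  qed
  moreover have "Ck_on k UNIV f" "Ck_on k UNIV g" using Suc.prems Ck_on_Suc_imp by blast+
  ultimately show ?case using Suc by (simp add: Ck_on_add)
qed (simp add: continuous_on_mult)

text \<open>The outer function is a whole sequence of successive derivatives, because the chain rule
  turns \<open>F n\<close> into \<open>F (Suc n)\<close> times a derivative of \<open>q\<close> and
  the induction on \<open>k\<close> must cover both. \<open>flat\<close> is such a sequence.\<close>

lemma Ck_on_compose:
  assumes "\<And>n t. (F n has_real_derivative F (Suc n) t) (at t)" and "\<And>k. Ck_on k UNIV q"
  shows "Ck_on k UNIV (\<lambda>x. F n (q x))"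
proof -
  have der: "((\<lambda>x. F n (q x)) has_derivative (\<lambda>h. F (Suc n) (q x) * frechet_derivative q (at x) h)) (at x)" for n x
  proof (rule has_derivative_compose[where g = "F n" and f = q and f' = "frechet_derivative q (at x)"])
    show "(q has_derivative frechet_derivative q (at x)) (at x)"
      using assms(2)[of "Suc 0"] by (auto simp: frechet_derivative_works[symmetric])
  qed (use assms(1) in \<open>simp add: has_field_derivative_def\<close>)
  show ?thesis
  proof (induction k arbitrary: n)
    case 0
    then show ?case using der by (auto intro!: continuous_at_imp_continuous_on has_derivative_continuous)
  next
    case (Suc k)
    have "frechet_derivative (\<lambda>x. F n (q x)) (at x) b = F (Suc n) (q x) * frechet_derivative q (at x) b" for x b
      using fun_cong[OF frechet_derivative_at[OF der[of n x]], of b] by simp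
    moreover have "Ck_on k UNIV (\<lambda>x. frechet_derivative q (at x) b)" if "b \<in> Basis" for b
      using assms(2)[of "Suc k"] that by simp
    moreover have "(\<lambda>x. F n (q x)) differentiable (at x)" for x
      using der unfolding differentiable_def by blast
    ultimately show ?case using Suc by (simp add: Ck_on_mult)
  qed
qed

lemma Ck_on_inner: "Ck_on k UNIV (\<lambda>x. x \<bullet> a)"
proof (cases k)
  case (Suc m)
  have der: "((\<lambda>x. x \<bullet> a) has_derivative (\<lambda>h. h \<bullet> a)) (at x)" for x :: 'a
    by (auto intro!: derivative_eq_intros)
  have "frechet_derivative (\<lambda>x. x \<bullet> a) (at x) b = b \<bullet> a" for x b :: 'a
    using fun_cong[OF frechet_derivative_at[OF der[of x]], of b] by simp
  then show ?thesis using der Suc by (auto simp: differentiable_def Ck_on_const)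
qed (auto intro!: continuous_intros)

lemma Ck_on_quadratic:
  fixes a c :: real
  shows "Ck_on k UNIV (\<lambda>x::'a::euclidean_space. c * (a - x \<bullet> x))"
proof (cases k)
  case (Suc m)
  have der: "((\<lambda>x. c * (a - x \<bullet> x)) has_derivative (\<lambda>h. (- 2 * c) * (x \<bullet> h))) (at x)" for x :: 'a
    by (auto intro!: derivative_eq_intros simp: inner_commute)
  have "frechet_derivative (\<lambda>x. c * (a - x \<bullet> x)) (at x) b = (- 2 * c) * (x \<bullet> b)" for x b :: 'a
    using fun_cong[OF frechet_derivative_at[OF der[of x]], of b] by simp
  moreover have "(\<lambda>x. c * (a - x \<bullet> x)) differentiable (at x)" for x :: 'a
    using der unfolding differentiable_def by blast
  moreover have "Ck_on m UNIV (\<lambda>x::'a. (- 2 * c) * (x \<bullet> b))" for b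
    by (intro Ck_on_mult Ck_on_const Ck_on_inner)
  ultimately show ?thesis using Suc by simp
qed (auto intro!: continuous_intros)

lemma flat_0: "flat 0 t = (if t > 0 then exp (- (1 / t)) else 0)"
  by (simp add: flat_def)

lemma flat_1: "flat (Suc 0) t = (if t > 0 then (1 / t)\<^sup>2 * exp (- (1 / t)) else 0)"
  by (simp add: flat_def power2_eq_square)

lemma flat_0_mono: "s \<le> t \<Longrightarrow> flat 0 s \<le> flat 0 t"
  by (auto simp: flat_0 frac_le)

text \<open>Using \<open>x \<bullet> x\<close> instead of the norm keeps the function smooth at the
  origin. The condition \<open>a < R\<^sup>2\<close> places the support inside a closed ball of
  radius \<open>sqrt a < R\<close>.\<close>

lemma bump:
  fixes a c :: real
  assumes "c > 0" "0 < a" "a < R\<^sup>2" "R > 0"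
  defines "v \<equiv> \<lambda>x::'a::euclidean_space. flat 0 (c * (a - x \<bullet> x))"
  shows "Cc_infty R v" "grad v x = (- 2 * c * flat 1 (c * (a - x \<bullet> x))) *\<^sub>R x"
proof -
  have "Ck_on k (ball 0 R) v" for k
    unfolding v_def by (rule Ck_on_subset[OF Ck_on_compose[where F = flat, OF flat_has_derivative Ck_on_quadratic]]) auto
  moreover have "v x = 0" if "x \<notin> cball 0 (sqrt a)" for x
  proof -
    have "sqrt a < norm x" using that by simp
    then have "(sqrt a)\<^sup>2 < (norm x)\<^sup>2" by (rule power_strict_mono) (use assms in auto)
    then have "a < (norm x)\<^sup>2" using assms by simp
    then have "c * (a - x \<bullet> x) < 0" using assms(1) by (simp add: power2_norm_eq_inner mult_pos_neg)
    then show ?thesis by (simp add: v_def flat_0)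
  qed
  moreover have "cball 0 (sqrt a) \<subseteq> ball (0::'a) R"
    using assms real_less_lsqrt[of R a] by (auto intro: le_less_trans)
  ultimately show "Cc_infty R v" unfolding Cc_infty_def by (metis compact_cball)
  have "(v has_derivative (\<lambda>h. flat 1 (c * (a - x \<bullet> x)) * ((- 2 * c) * (x \<bullet> h)))) (at x)"
    unfolding v_def
  proof (rule has_derivative_compose[where g = "flat 0" and f = "\<lambda>x. c * (a - x \<bullet> x)" and f' = "\<lambda>h. (- 2 * c) * (x \<bullet> h)"])
    show "((\<lambda>x. c * (a - x \<bullet> x)) has_derivative (\<lambda>h. (- 2 * c) * (x \<bullet> h))) (at x)"
      by (auto intro!: derivative_eq_intros simp: inner_commute)
  qed (use flat_has_derivative[of 0] in \<open>simp add: has_field_derivative_def\<close>)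
  then show "grad v x = (- 2 * c * flat 1 (c * (a - x \<bullet> x))) *\<^sub>R x"
    by (intro grad_eqI) (simp add: algebra_simps)
qed

text \<open>Two parameters move together: \<open>a j\<close> pushes the radius of the support to
  \<open>R\<close>, and the factor \<open>Suc j\<close> drives the argument of \<open>flat 0\<close>
  to infinity inside the ball, where the profile tends to 1. The last property says that the
  gradients are eventually concentrated near the sphere.\<close>

lemma exhausting_bumps:
  assumes R: "R > 0"
  obtains v :: "nat \<Rightarrow> 'a::euclidean_space \<Rightarrow> real" where
    "\<And>j. Cc_infty R (v j)" "\<And>j x. v j x \<le> 1"
    "\<And>j x y. norm x \<le> norm y \<Longrightarrow> 0 \<le> v j y \<and> v j y \<le> v j x"
    "\<And>x. norm x < R \<Longrightarrow> (\<lambda>j. v j x) \<longlonglongrightarrow> 1"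
    "\<And>j x. \<bar>grad (v j) x \<bullet> x\<bar> = norm (grad (v j) x) * norm x"
    "\<And>r e. r < R \<Longrightarrow> e > 0 \<Longrightarrow> \<forall>\<^sub>F j in sequentially. \<forall>x. norm x \<le> r \<longrightarrow> norm (grad (v j) x) \<le> e"
proof -
  \<comment> \<open>The shift by two keeps \<open>a 0\<close> positive.\<close>
  define a where "a = (\<lambda>j. R\<^sup>2 * (1 - 1 / real (Suc (Suc j))))"
  define v where "v = (\<lambda>j (x::'a). flat 0 (real (Suc j) * (a j - x \<bullet> x)))"
  have a: "0 < a j" "a j < R\<^sup>2" for j
    using R mult_strict_left_mono[of "1 - 1 / real (Suc (Suc j))" 1 "R\<^sup>2"] unfolding a_def
    by (auto intro!: mult_pos_pos)
  have e0: "(\<lambda>j. 1 / real (Suc j)) \<longlonglongrightarrow> 0" using LIMSEQ_inverse_real_of_nat by (simp add: inverse_eq_divide)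
  then have "(\<lambda>j. 1 / real (Suc (Suc j))) \<longlonglongrightarrow> 0" by (rule LIMSEQ_Suc)
  then have "a \<longlonglongrightarrow> R\<^sup>2 * (1 - 0)" unfolding a_def by (intro tendsto_intros)
  then have alim: "a \<longlonglongrightarrow> R\<^sup>2" by simp
  have gr: "grad (v j) x = (- 2 * real (Suc j) * flat 1 (real (Suc j) * (a j - x \<bullet> x))) *\<^sub>R x" for j x
    unfolding v_def by (rule bump) (use a R in auto)
  show ?thesis
  proof (rule that[of v])
    show "Cc_infty R (v j)" for j unfolding v_def by (rule bump) (use a R in auto)
    show "v j x \<le> 1" for j x by (simp add: v_def flat_0)
    show "0 \<le> v j y \<and> v j y \<le> v j x" if "norm x \<le> norm y" for j x y
    proof
      show "0 \<le> v j y" by (simp add: v_def flat_0)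
      have "x \<bullet> x \<le> y \<bullet> y" using that by (simp add: norm_le)
      then show "v j y \<le> v j x" unfolding v_def by (intro flat_0_mono mult_left_mono) auto
    qed
    show "\<bar>grad (v j) x \<bullet> x\<bar> = norm (grad (v j) x) * norm x" for j x
      unfolding gr by (simp add: abs_mult power2_norm_eq_inner[symmetric] power2_eq_square)
    show "(\<lambda>j. v j x) \<longlonglongrightarrow> 1" if "norm x < R" for x
    proof -
      have "x \<bullet> x < R\<^sup>2" using that by (simp add: power2_norm_eq_inner[symmetric] power_strict_mono)
      then have "filterlim (\<lambda>j. (a j - x \<bullet> x) * real (Suc j)) at_top sequentially"
        by (intro filterlim_tendsto_pos_mult_at_top[of _ "R\<^sup>2 - x \<bullet> x"] tendsto_intros alim
            filterlim_compose[OF filterlim_real_sequentially filterlim_Suc]) auto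
      moreover have "(flat 0 \<longlongrightarrow> 1) at_top"
      proof -
        have "((\<lambda>t. exp (- (inverse t)) :: real) \<longlongrightarrow> exp (- 0)) at_top"
          by (intro tendsto_intros tendsto_inverse_0_at_top filterlim_ident)
        moreover have "\<forall>\<^sub>F t in at_top. exp (- (inverse t)) = flat 0 t"
          by (rule eventually_mono[OF eventually_gt_at_top[of 0]]) (simp add: flat_0 inverse_eq_divide)
        ultimately show ?thesis by (simp add: tendsto_cong)
      qed
      ultimately show ?thesis unfolding v_def by (simp add: mult.commute filterlim_compose[of "flat 0"])
    qed
    fix r e :: real assume r: "r < R" and e: "e > 0"
    show "\<forall>\<^sub>F j in sequentially. \<forall>x. norm x \<le> r \<longrightarrow> norm (grad (v j) x) \<le> e"
    proof (cases "r < 0")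
      case True
      then show ?thesis by (auto intro!: always_eventually dest: order_trans[OF norm_ge_zero])
    next
      case False
      then have rR: "r\<^sup>2 < R\<^sup>2" using r by (simp add: power_strict_mono)
      \<comment> \<open>The estimate \<open>flat 1 t \<le> (1 / t)\<^sup>2\<close> yields two powers
        of \<open>Suc j\<close>, one more than the chain rule produces; this leaves the decaying
        factor in \<open>b\<close>.\<close>
      define b where "b = (\<lambda>j. 2 * r * (1 / real (Suc j)) / (a j - r\<^sup>2)\<^sup>2)"
      have "b \<longlonglongrightarrow> 2 * r * 0 / (R\<^sup>2 - r\<^sup>2)\<^sup>2"
        unfolding b_def using rR by (intro tendsto_intros alim e0) auto
      then have "\<forall>\<^sub>F j in sequentially. b j < e" using e by (intro order_tendstoD) auto
      moreover have "\<forall>\<^sub>F j in sequentially. r\<^sup>2 < a j" using alim rR by (rule order_tendstoD)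
      ultimately show ?thesis
      proof eventually_elim
        case (elim j)
        show ?case
        proof (intro allI impI)
          fix x :: 'a assume x: "norm x \<le> r"
          define q where "q = a j - x \<bullet> x"
          define N where "N = real (Suc j)"
          have N: "N > 0" by (simp add: N_def)
          have "x \<bullet> x \<le> r\<^sup>2" using x by (simp add: power2_norm_eq_inner[symmetric] power_mono)
          then have q: "0 < a j - r\<^sup>2" "a j - r\<^sup>2 \<le> q" using elim by (auto simp: q_def)
          have f: "0 \<le> flat 1 (N * q)" "flat 1 (N * q) \<le> (1 / (N * q))\<^sup>2"
            using N q by (auto simp: flat_1 mult_left_le)
          have "norm (grad (v j) x) = 2 * N * flat 1 (N * q) * norm x"
            unfolding gr using f N by (simp add: N_def q_def abs_mult)
          also have "\<dots> \<le> 2 * N * (1 / (N * q))\<^sup>2 * r"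
            using f N x by (intro mult_mono) auto
          also have "\<dots> = 2 * r * (1 / N) / q\<^sup>2" using N by (simp add: power2_eq_square)
          also have "\<dots> \<le> b j"
            unfolding b_def N_def using q False by (intro divide_left_mono power_mono mult_nonneg_nonneg mult_pos_pos) auto
          finally show "norm (grad (v j) x) \<le> e" using elim by simp
        qed
      qed
    qed
  qed
qed

section \<open>The Hardy inequality\<close>

lemma loc_bounded_sum:
  assumes "\<And>k. k \<in> A \<Longrightarrow> loc_bounded R (h k)"
  shows "loc_bounded R (\<lambda>r. \<Sum>k\<in>A. h k r)"
  using assms
proof (induction A rule: infinite_finite_induct)
  case (insert k A)
  then have "loc_bounded R (\<lambda>r. h k r + (\<Sum>k\<in>A. h k r))" by (intro loc_bounded_add) auto
  then show ?case using insert by simp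
qed (auto simp: loc_bounded_def)

lemma loc_bounded_powr: "loc_bounded R (\<lambda>r. (R - r) powr a)"
  by (rule loc_bounded_continuous) (auto intro!: continuous_intros)

section \<open>The logarithmic weight\<close>

lemma log_term_ge_1:
  assumes "0 \<le> r" "r < (R::real)"
  shows "1 \<le> 1 - ln ((R - r) / R)"
  using assms by (simp add: ln_le_zero_iff)

lemma Xf_pos:
  assumes "0 \<le> r" "r < R"
  shows "0 < Xf ((R - r) / R)"
proof -
  have "0 < 1 - ln ((R - r) / R)" using log_term_ge_1[OF assms] by linarith
  then show ?thesis unfolding Xf_def by (rule divide_pos_pos[OF zero_less_one])
qed

lemma Xf_le_1:
  assumes "0 \<le> r" "r < R"
  shows "Xf ((R - r) / R) \<le> 1"
proof -
  have "0 < 1 - ln ((R - r) / R)" using log_term_ge_1[OF assms] by linarith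
  then show ?thesis unfolding Xf_def using log_term_ge_1[OF assms] by (subst divide_le_eq_1_pos)
qed

lemma continuous_on_Xf: "continuous_on {0..<R} (\<lambda>r. Xf ((R - r) / R))"
proof -
  have [simp]: "ln ((R - r) / R) \<noteq> 1" "1 \<noteq> ln ((R - r) / R)" if "0 \<le> r" "r < R" for r
    using log_term_ge_1[OF that] by linarith+
  show ?thesis unfolding Xf_def by (intro continuous_intros ballI) auto
qed

lemma loc_bounded_Xf: "loc_bounded R (\<lambda>r. Xf ((R - r) / R) / (R - r))"
proof (rule loc_bounded_continuous)
  show "continuous_on {0..<R} (\<lambda>r. Xf ((R - r) / R) / (R - r))"
    by (intro continuous_intros continuous_on_Xf) auto
qed (simp add: Xf_def)

lemma loc_bounded_Xf_powr: "loc_bounded R (\<lambda>r. Xf ((R - r) / R) powr \<gamma> / (R - r))"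
proof (rule loc_bounded_continuous)
  show "continuous_on {0..<R} (\<lambda>r. Xf ((R - r) / R) powr \<gamma> / (R - r))"
    using Xf_pos[of _ R] by (intro continuous_intros continuous_on_Xf ballI) force+
qed (simp add: Xf_def)

lemma Cc_infty_integrals:
  fixes u :: "'a::euclidean_space \<Rightarrow> real"
  assumes u: "Cc_infty R u" and R: "R > 0" and k: "loc_bounded R k"
  shows "integrable lborel (\<lambda>x. \<bar>u x\<bar> * k (norm x))"
    and "integral (ball 0 R) (\<lambda>x. \<bar>u x\<bar> * k (norm x)) = (LINT x|lborel. \<bar>u x\<bar> * k (norm x))"
    and "integrable lborel (\<lambda>x. norm (grad u x) * k (norm x))"
    and "integral (ball 0 R) (\<lambda>x. norm (grad u x) * k (norm x)) = (LINT x|lborel. norm (grad u x) * k (norm x))"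
    and "integrable lborel (\<lambda>x. \<bar>grad u x \<bullet> x\<bar> * k (norm x))"
proof -
  obtain \<rho> L where \<rho>: "0 < \<rho>" "\<rho> < R"
    and u0: "\<And>x. \<rho> < norm x \<Longrightarrow> u x = 0" and g0: "\<And>x. \<rho> < norm x \<Longrightarrow> grad u x = 0"
    and gc: "continuous_on UNIV (grad u)" and L: "\<And>x. norm (grad u x) \<le> L"
    by (rule Cc_inftyE[OF u R], blast)
  note uc = Cc_infty_continuous[OF u R]
  have [measurable]: "u \<in> borel_measurable borel" "grad u \<in> borel_measurable borel"
    using uc gc borel_measurable_continuous_onI by auto
  have "compact (u ` cball 0 \<rho>)"
    by (intro compact_continuous_image continuous_on_subset[OF uc]) auto
  then obtain B where B: "\<And>x. x \<in> cball 0 \<rho> \<Longrightarrow> norm (u x) \<le> B"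
    using compact_imp_bounded bounded_iff by (metis image_eqI)
  have B': "\<bar>u x\<bar> \<le> max 0 B" for x
    using B[of x] u0[of x] by (cases "norm x \<le> \<rho>") auto
  show i1: "integrable lborel (\<lambda>x. \<bar>u x\<bar> * k (norm x))"
    by (rule integrable_radial_weight[OF k \<rho>(2)]) (use B' u0 in auto)
  show "integral (ball 0 R) (\<lambda>x. \<bar>u x\<bar> * k (norm x)) = (LINT x|lborel. \<bar>u x\<bar> * k (norm x))"
    by (rule integral_ball_eq_lborel[OF i1]) (use u0 \<rho> in auto)
  show i2: "integrable lborel (\<lambda>x. norm (grad u x) * k (norm x))"
    by (rule integrable_radial_weight[OF k \<rho>(2)]) (use L g0 in auto)
  show "integral (ball 0 R) (\<lambda>x. norm (grad u x) * k (norm x)) = (LINT x|lborel. norm (grad u x) * k (norm x))"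
    by (rule integral_ball_eq_lborel[OF i2]) (use g0 \<rho> in auto)
  show "integrable lborel (\<lambda>x. \<bar>grad u x \<bullet> x\<bar> * k (norm x))"
  proof (rule integrable_radial_weight[OF k \<rho>(2)])
    fix x
    show "\<bar>\<bar>grad u x \<bullet> x\<bar>\<bar> \<le> L * \<rho>"
    proof (cases "norm x \<le> \<rho>")
      case True
      have "\<bar>grad u x \<bullet> x\<bar> \<le> norm (grad u x) * norm x" by (rule Cauchy_Schwarz_ineq2)
      also have "\<dots> \<le> L * \<rho>" using L[of x] True order_trans[OF norm_ge_zero L] by (intro mult_mono) auto
      finally show ?thesis by simp
    next
      case False
      then show ?thesis using g0[of x] \<rho> order_trans[OF norm_ge_zero L] by simp
    qed
  qed (use g0 in auto)
qed

lemma Cc_infty_outside: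
  fixes u :: "'a::euclidean_space \<Rightarrow> real"
  assumes "Cc_infty R u" "R > 0" "R \<le> norm x"
  shows "u x = 0" "grad u x = 0"
  using Cc_inftyE[OF assms(1,2)] assms(3) by (metis less_le_trans)+

section \<open>The combined Hardy weight (with \<open>N\<close> = n - 1) and the divergence of the
  Hardy field\<close>

definition sum_weight :: "real \<Rightarrow> real \<Rightarrow> real \<Rightarrow> nat \<Rightarrow> real \<Rightarrow> real" where
  "sum_weight R N s m r = (s - 1) * (R - r) powr (- s) + (\<Sum>k=1..m. N / R ^ k * (R - r) powr (real k - s))"

lemma loc_bounded_sum_weight: "loc_bounded R (sum_weight R N s m)"
  unfolding sum_weight_def by (intro loc_bounded_add loc_bounded_cmult loc_bounded_sum loc_bounded_powr)

lemma divide_dB_powr: "a / dB R x powr s = a * (R - norm x) powr (- s)"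
  by (simp add: dB_def powr_minus divide_inverse)

lemma Im_eq:
  fixes u :: "'a::euclidean_space \<Rightarrow> real"
  assumes u: "Cc_infty R u" and R: "R > 0"
  shows "Im R s m u = (LINT x|lborel. norm (grad u x) * (R - norm x) powr (1 - s))
      - (LINT x|lborel. \<bar>u x\<bar> * sum_weight R (real DIM('a) - 1) s m (norm x))"
proof -
  note I = Cc_infty_integrals[OF u R loc_bounded_powr]
  have "(LINT x|lborel. \<bar>u x\<bar> * sum_weight R (real DIM('a) - 1) s m (norm x)) =
    (LINT x|lborel. (s - 1) * (\<bar>u x\<bar> * (R - norm x) powr (- s)) +
       (\<Sum>k=1..m. (real DIM('a) - 1) / R ^ k * (\<bar>u x\<bar> * (R - norm x) powr (real k - s))))"
    by (rule Bochner_Integration.integral_cong) (auto simp: sum_weight_def sum_distrib_left algebra_simps)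
  also have "\<dots> = (s - 1) * (LINT x|lborel. \<bar>u x\<bar> * (R - norm x) powr (- s)) +
       (\<Sum>k=1..m. (real DIM('a) - 1) / R ^ k * (LINT x|lborel. \<bar>u x\<bar> * (R - norm x) powr (real k - s)))"
    using I(1) by (subst Bochner_Integration.integral_add) (auto intro!: Bochner_Integration.integrable_sum)
  finally show ?thesis
    unfolding Im_def I0_def divide_dB_powr using I(2,4) by simp
qed

text \<open>The first term alone would give the sharp constants, but its field is singular at the
  origin; the subtracted term makes it vanish there and its derivative produces the logarithmic
  remainder.\<close>

definition hardy_field :: "real \<Rightarrow> real \<Rightarrow> real \<Rightarrow> real \<Rightarrow> real" where
  "hardy_field R s \<gamma> r = (R - r) powr (1 - s) - R powr (1 - s) * Xf ((R - r) / R) powr (\<gamma> - 1)"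

definition hardy_field' :: "real \<Rightarrow> real \<Rightarrow> real \<Rightarrow> real \<Rightarrow> real" where
  "hardy_field' R s \<gamma> r = (s - 1) * (R - r) powr (- s) + R powr (1 - s) * (\<gamma> - 1) * (Xf ((R - r) / R) powr \<gamma> / (R - r))"

text \<open>The origin of the constant \<open>\<gamma> - 1\<close>: since X' = X^2 / t, the power
  \<open>\<gamma> - 1\<close> of X has derivative (\<gamma> - 1) X^\<gamma> / t. The sign comes from
  t = (R - r) / R decreasing in \<open>r\<close>.\<close>

lemma Xf_powr_derivative:
  assumes r: "0 \<le> r" "r < R"
  shows "((\<lambda>r. Xf ((R - r) / R) powr (\<gamma> - 1)) has_real_derivative
      - ((\<gamma> - 1) * (Xf ((R - r) / R) powr \<gamma> / (R - r)))) (at r)"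
proof -
  have eq: "Xf t powr a = (1 - ln t) powr (- a)" if "0 < 1 - ln t" for t a
    using that by (simp add: Xf_def powr_divide powr_minus divide_inverse inverse_powr)
  have L: "0 < 1 - ln ((R - r) / R)" using log_term_ge_1[OF r] by simp
  have "((\<lambda>r. 1 - ln ((R - r) / R)) has_real_derivative 1 / (R - r)) (at r)"
    using r by (auto intro!: derivative_eq_intros simp: field_simps)
  from DERIV_powr[OF this L, of "\<lambda>_. - (\<gamma> - 1)" 0]
  have "((\<lambda>r. (1 - ln ((R - r) / R)) powr (- (\<gamma> - 1))) has_real_derivative
      (1 - ln ((R - r) / R)) powr (- (\<gamma> - 1)) * (0 * ln (1 - ln ((R - r) / R))
       + 1 / (R - r) * - (\<gamma> - 1) / (1 - ln ((R - r) / R)))) (at r)" by simp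
  also have "(1 - ln ((R - r) / R)) powr (- (\<gamma> - 1)) * (0 * ln (1 - ln ((R - r) / R))
       + 1 / (R - r) * - (\<gamma> - 1) / (1 - ln ((R - r) / R))) = - ((\<gamma> - 1) * (Xf ((R - r) / R) powr \<gamma> / (R - r)))"
  proof -
    have h: "(1 - ln ((R - r) / R)) powr (- (\<gamma> - 1)) = (1 - ln ((R - r) / R)) powr (- \<gamma>) * (1 - ln ((R - r) / R))"
      using L powr_add[of "1 - ln ((R - r) / R)" "- \<gamma>" 1] by simp
    have alg: "p * l * (0 * t + 1 / d * - (\<gamma> - 1) / l) = - ((\<gamma> - 1) * (p / d))" if "l \<noteq> 0" for p l t d :: real
      using that by (cases "d = 0") (simp_all add: field_simps)
    have "1 - ln ((R - r) / R) \<noteq> 0" using L by simp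
    from alg[OF this] show ?thesis by (simp only: eq[OF L] h)
  qed
  finally have D: "((\<lambda>r. (1 - ln ((R - r) / R)) powr (- (\<gamma> - 1))) has_real_derivative
      - ((\<gamma> - 1) * (Xf ((R - r) / R) powr \<gamma> / (R - r)))) (at r)" .
  \<comment> \<open>The rewriting \<open>eq\<close> needs a positive logarithmic term on a whole
    neighbourhood, which at \<open>r = 0\<close> includes negative radii; continuity provides
    it.\<close>
  have "isCont (\<lambda>r. 1 - ln ((R - r) / R)) r"
    using r by (intro continuous_intros) auto
  then have "((\<lambda>r. 1 - ln ((R - r) / R)) \<longlongrightarrow> 1 - ln ((R - r) / R)) (nhds r)"
    using tendsto_at_iff_tendsto_nhds[of "\<lambda>r. 1 - ln ((R - r) / R)" r] by (simp add: isCont_def)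
  then have "\<forall>\<^sub>F x in nhds r. 0 < 1 - ln ((R - x) / R)"
    using L by (rule order_tendstoD)
  then have "\<forall>\<^sub>F x in nhds r. Xf ((R - x) / R) powr (\<gamma> - 1) = (1 - ln ((R - x) / R)) powr (- (\<gamma> - 1))"
    by eventually_elim (rule eq)
  from DERIV_cong_ev[OF refl this refl] D show ?thesis by blast
qed

lemma hardy_field_derivative:
  assumes r: "0 \<le> r" "r < R"
  shows "(hardy_field R s \<gamma> has_real_derivative hardy_field' R s \<gamma> r) (at r)"
proof -
  have 1: "((\<lambda>r. (R - r) powr (1 - s)) has_real_derivative (s - 1) * (R - r) powr (- s)) (at r)"
    using r DERIV_fun_powr[of "\<lambda>r. R - r" "- 1" r "1 - s"] by (auto intro!: derivative_eq_intros simp: algebra_simps)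
  have "((\<lambda>r. (R - r) powr (1 - s) - R powr (1 - s) * Xf ((R - r) / R) powr (\<gamma> - 1)) has_real_derivative
    (s - 1) * (R - r) powr (- s) - R powr (1 - s) * - ((\<gamma> - 1) * (Xf ((R - r) / R) powr \<gamma> / (R - r)))) (at r)"
    by (intro DERIV_diff 1 DERIV_cmult Xf_powr_derivative r)
  then show ?thesis unfolding hardy_field_def[abs_def] hardy_field'_def
    by (simp only: mult_minus_right diff_minus_eq_add mult.assoc)
qed

lemma hardy_field_0: "R > 0 \<Longrightarrow> hardy_field R s \<gamma> 0 = 0"
  by (simp add: hardy_field_def Xf_def)

lemma hardy_field_measurable [measurable]: "hardy_field R s \<gamma> \<in> borel_measurable borel"
  unfolding hardy_field_def[abs_def] Xf_def[abs_def] by measurable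

lemma loc_bounded_hardy_field': "loc_bounded R (hardy_field' R s \<gamma>)"
  unfolding hardy_field'_def[abs_def] by (intro loc_bounded_add loc_bounded_cmult loc_bounded_powr loc_bounded_Xf_powr)

lemma hardy_field_ge:
  assumes "0 \<le> r" "r < R" "1 \<le> \<gamma>"
  shows "(R - r) powr (1 - s) - R powr (1 - s) \<le> hardy_field R s \<gamma> r"
proof -
  have "Xf ((R - r) / R) powr (\<gamma> - 1) \<le> 1"
    using Xf_pos[OF assms(1,2)] Xf_le_1[OF assms(1,2)] assms(3) by (intro powr_le1) auto
  then show ?thesis unfolding hardy_field_def by (simp add: mult_left_le)
qed

lemma hardy_field_nonneg:
  assumes "0 \<le> r" "r < R" "1 \<le> \<gamma>" "1 \<le> s"
  shows "0 \<le> hardy_field R s \<gamma> r"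
proof -
  have "R powr (1 - s) \<le> (R - r) powr (1 - s)" using assms by (intro powr_mono2') auto
  then show ?thesis using hardy_field_ge[OF assms(1-3), of s] by simp
qed

text \<open>A geometric sum with its exact remainder. With d = R - r, each step uses d^a - R^a = d^a
  r / R + (d^(a+1) - R^(a+1)) / R for a = m + 1 - s.\<close>

lemma powr_difference_quotient_expansion:
  fixes R r s :: real
  assumes "0 < r" "r < R"
  shows "((R - r) powr (1 - s) - R powr (1 - s)) / r = (\<Sum>k=1..m. (R - r) powr (real k - s) / R ^ k)
     + ((R - r) powr (real m + 1 - s) - R powr (real m + 1 - s)) / (r * R ^ m)"
proof (induction m)
  case (Suc m)
  have 1: "R powr (real (Suc m) + 1 - s) = R powr (real m + 1 - s) * R"
    using assms powr_add[of R "real m + 1 - s" 1] by (simp add: algebra_simps)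
  have 2: "(R - r) powr (real (Suc m) + 1 - s) = (R - r) powr (real m + 1 - s) * (R - r)"
    using assms powr_add[of "R - r" "real m + 1 - s" 1] by (simp add: algebra_simps)
  have 3: "(R - r) powr (real (Suc m) - s) = (R - r) powr (real m + 1 - s)"
    by (simp add: algebra_simps)
  have "((R - r) powr (real m + 1 - s) - R powr (real m + 1 - s)) / (r * R ^ m) =
    (R - r) powr (real (Suc m) - s) / R ^ Suc m
    + ((R - r) powr (real (Suc m) + 1 - s) - R powr (real (Suc m) + 1 - s)) / (r * R ^ Suc m)"
    unfolding 1 2 3 using assms by (simp add: field_simps)
  then show ?case using Suc by simp
qed simp

text \<open>For \<open>\<gamma> = 1\<close> the logarithmic terms disappear and the expansion is
  exact. The sign of the right side decides the inequality, and its size near the sphere decides the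
  optimal constants.\<close>

lemma sum_weight_eq:
  assumes "0 < r" "r < R"
  shows "hardy_field' R s 1 r + N * (hardy_field R s 1 r / r) - sum_weight R N s m r
     = N * (((R - r) powr (real m + 1 - s) - R powr (real m + 1 - s)) / (r * R ^ m))"
proof -
  have "hardy_field R s 1 r / r = ((R - r) powr (1 - s) - R powr (1 - s)) / r"
    using Xf_pos[of r R] assms by (simp add: hardy_field_def)
  then show ?thesis
    unfolding powr_difference_quotient_expansion[OF assms, of s m] sum_weight_def hardy_field'_def
    by (simp add: algebra_simps sum_distrib_left)
qed

text \<open>The remainder of the expansion is nonnegative because its exponent
  \<open>m + 1 - s\<close> is at most 0, which is why the sum may run up to the integer part of
  \<open>s\<close> minus one. Passing from \<open>\<gamma> = 1\<close> to larger
  \<open>\<gamma>\<close> can only enlarge the field, as X \<le> 1, and adds the logarithmic term to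
  its derivative.\<close>

lemma sum_weight_le:
  assumes "0 < r" "r < R" "0 \<le> N" "1 \<le> \<gamma>" "real m + 1 \<le> s"
  shows "sum_weight R N s m r + R powr (1 - s) * (\<gamma> - 1) * (Xf ((R - r) / R) powr \<gamma> / (R - r))
     \<le> hardy_field' R s \<gamma> r + N * (hardy_field R s \<gamma> r / r)"
proof -
  have "R powr (real m + 1 - s) \<le> (R - r) powr (real m + 1 - s)" using assms by (intro powr_mono2') auto
  then have "0 \<le> N * (((R - r) powr (real m + 1 - s) - R powr (real m + 1 - s)) / (r * R ^ m))"
    using assms by (intro mult_nonneg_nonneg divide_nonneg_nonneg) auto
  moreover have "hardy_field R s 1 r \<le> hardy_field R s \<gamma> r"
    using hardy_field_ge[of r R \<gamma> s] assms Xf_pos[of r R] by (simp add: hardy_field_def)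
  then have "N * (hardy_field R s 1 r / r) \<le> N * (hardy_field R s \<gamma> r / r)"
    using assms by (intro mult_left_mono divide_right_mono) auto
  ultimately show ?thesis
    using sum_weight_eq[OF assms(1,2), of s N m] by (simp add: hardy_field'_def)
qed

text \<open>The comparison of weights, the divergence theorem and the Cauchy-Schwarz inequality are
  chained. The case \<open>\<gamma> = 1\<close>, where the left side is 0, is included because it
  says that \<open>Im\<close> is nonnegative; that gives the lower bounds for the infima.\<close>

lemma hardy_inequality:
  fixes u :: "'a::euclidean_space \<Rightarrow> real"
  assumes u: "Cc_infty R u" and R: "R > 0" and s: "real m + 1 \<le> s" and \<gamma>: "1 \<le> \<gamma>"
  shows "(\<gamma> - 1) / R powr (s - 1) * integral (ball 0 R) (\<lambda>x. \<bar>u x\<bar> / dB R x * Xf (dB R x / R) powr \<gamma>)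
     \<le> Im R s m u"
proof -
  define N where "N = real DIM('a) - 1"
  have N: "N \<ge> 0" using DIM_positive[where 'a='a] unfolding N_def by simp
  note lf = loc_bounded_quotient[OF hardy_field_0[OF R] hardy_field_derivative hardy_field_measurable loc_bounded_hardy_field']
  have X: "integral (ball 0 R) (\<lambda>x. \<bar>u x\<bar> / dB R x * Xf (dB R x / R) powr \<gamma>) =
      (LINT x|lborel. \<bar>u x\<bar> * (Xf ((R - norm x) / R) powr \<gamma> / (R - norm x)))"
    using Cc_infty_integrals(2)[OF u R loc_bounded_Xf_powr[of R \<gamma>]] by (simp add: dB_def)
  note iX = Cc_infty_integrals(1)[OF u R loc_bounded_Xf_powr[of R \<gamma>]]
  note iS = Cc_infty_integrals(1)[OF u R loc_bounded_sum_weight[of R N s m]]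
  have lD: "loc_bounded R (\<lambda>r. hardy_field' R s \<gamma> r + N * (hardy_field R s \<gamma> r / r))"
    by (intro loc_bounded_add loc_bounded_cmult lf loc_bounded_hardy_field')
  have lS: "loc_bounded R (\<lambda>r. sum_weight R N s m r + R powr (1 - s) * (\<gamma> - 1) * (Xf ((R - r) / R) powr \<gamma> / (R - r)))"
    by (intro loc_bounded_add loc_bounded_cmult loc_bounded_sum_weight loc_bounded_Xf_powr)
  have "(LINT x|lborel. \<bar>u x\<bar> * sum_weight R N s m (norm x)) +
     R powr (1 - s) * (\<gamma> - 1) * (LINT x|lborel. \<bar>u x\<bar> * (Xf ((R - norm x) / R) powr \<gamma> / (R - norm x)))
    = (LINT x|lborel. \<bar>u x\<bar> * sum_weight R N s m (norm x) +
     R powr (1 - s) * (\<gamma> - 1) * (\<bar>u x\<bar> * (Xf ((R - norm x) / R) powr \<gamma> / (R - norm x))))"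
    by (simp only: Bochner_Integration.integral_add[OF iS integrable_mult_right[OF iX]] integral_mult_right_zero)
  also have "\<dots> = (LINT x|lborel. \<bar>u x\<bar> * (sum_weight R N s m (norm x) +
     R powr (1 - s) * (\<gamma> - 1) * (Xf ((R - norm x) / R) powr \<gamma> / (R - norm x))))"
    by (rule Bochner_Integration.integral_cong) (auto simp: algebra_simps)
  also have "\<dots> \<le> (LINT x|lborel. \<bar>u x\<bar> * (hardy_field' R s \<gamma> (norm x) + N * (hardy_field R s \<gamma> (norm x) / norm x)))"
  proof (rule integral_mono_AE[OF Cc_infty_integrals(1)[OF u R lS] Cc_infty_integrals(1)[OF u R lD]])
    have "AE x in lborel. x \<noteq> (0::'a)" by (rule AE_lborel_singleton)
    then show "AE x in lborel. \<bar>u x\<bar> * (sum_weight R N s m (norm x) +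
     R powr (1 - s) * (\<gamma> - 1) * (Xf ((R - norm x) / R) powr \<gamma> / (R - norm x)))
      \<le> \<bar>u x\<bar> * (hardy_field' R s \<gamma> (norm x) + N * (hardy_field R s \<gamma> (norm x) / norm x))"
    proof eventually_elim
      case (elim x)
      show ?case
      proof (cases "norm x < R")
        case True
        then show ?thesis using elim by (intro mult_left_mono sum_weight_le N \<gamma> s) auto
      next
        case False
        then show ?thesis using Cc_infty_outside[OF u R, of x] by simp
      qed
    qed
  qed
  also have "\<dots> \<le> (LINT x|lborel. \<bar>grad u x \<bullet> x\<bar> * (hardy_field R s \<gamma> (norm x) / norm x))"
    unfolding N_def using s \<gamma>
    by (intro radial_divergence(1)[OF u R hardy_field_0[OF R] hardy_field_derivative hardy_field_measurable loc_bounded_hardy_field' hardy_field_nonneg]) auto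
  also have "\<dots> \<le> (LINT x|lborel. norm (grad u x) * (R - norm x) powr (1 - s))"
  proof (rule integral_mono[OF Cc_infty_integrals(5)[OF u R lf] Cc_infty_integrals(3)[OF u R loc_bounded_powr]])
    fix x
    show "\<bar>grad u x \<bullet> x\<bar> * (hardy_field R s \<gamma> (norm x) / norm x) \<le> norm (grad u x) * (R - norm x) powr (1 - s)"
    proof (cases "norm x < R \<and> x \<noteq> 0")
      case True
      have "hardy_field R s \<gamma> (norm x) \<le> (R - norm x) powr (1 - s)" by (simp add: hardy_field_def)
      moreover have "0 \<le> hardy_field R s \<gamma> (norm x)" using True s \<gamma> by (intro hardy_field_nonneg) auto
      moreover have "\<bar>grad u x \<bullet> x\<bar> / norm x \<le> norm (grad u x)"
        using Cauchy_Schwarz_ineq2[of "grad u x" x] True by (simp add: divide_le_eq)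
      ultimately have "\<bar>grad u x \<bullet> x\<bar> / norm x * hardy_field R s \<gamma> (norm x) \<le> norm (grad u x) * (R - norm x) powr (1 - s)"
        by (intro mult_mono) auto
      then show ?thesis by simp
    next
      case False
      then show ?thesis using Cc_infty_outside[OF u R, of x] by auto
    qed
  qed auto
  finally have "(LINT x|lborel. \<bar>u x\<bar> * sum_weight R N s m (norm x)) +
     R powr (1 - s) * (\<gamma> - 1) * (LINT x|lborel. \<bar>u x\<bar> * (Xf ((R - norm x) / R) powr \<gamma> / (R - norm x)))
     \<le> (LINT x|lborel. norm (grad u x) * (R - norm x) powr (1 - s))" .
  moreover have "R powr (1 - s) * (\<gamma> - 1) = (\<gamma> - 1) / R powr (s - 1)"
    using powr_minus_divide[of R "s - 1"] by simp
  ultimately show ?thesis unfolding X Im_eq[OF u R] N_def by simp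
qed

section \<open>Optimality\<close>

text \<open>The conclusions of \<open>exhausting_bumps\<close>, taken as assumptions so that the
  limit arguments do not depend on the explicit formula of the bumps.\<close>

locale exhaustion =
  fixes R :: real and v :: "nat \<Rightarrow> 'a::euclidean_space \<Rightarrow> real"
  assumes R: "R > 0"
    and Cc: "Cc_infty R (v j)"
    and le_1: "v j x \<le> 1"
    and mono: "norm x \<le> norm y \<Longrightarrow> 0 \<le> v j y \<and> v j y \<le> v j x"
    and lim: "norm x < R \<Longrightarrow> (\<lambda>j. v j x) \<longlonglongrightarrow> 1"
    and radial: "\<bar>grad (v j) x \<bullet> x\<bar> = norm (grad (v j) x) * norm x"
    and grad_small: "r < R \<Longrightarrow> e > 0 \<Longrightarrow> \<forall>\<^sub>F j in sequentially. \<forall>x. norm x \<le> r \<longrightarrow> norm (grad (v j) x) \<le> e"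
begin

section \<open>Mass, total gradient and logarithmic integral along the exhausting sequence\<close>

definition vol :: real where "vol = measure lborel (ball (0::'a) R)"

lemma vol_pos: "vol > 0"
  unfolding vol_def using R by (simp add: content_ball_pos)

lemma nonneg: "0 \<le> v j x"
  using mono[of x x] by simp

lemma one: "loc_bounded R (\<lambda>_. 1)"
  unfolding loc_bounded_def by auto

lemma integrable_ball: "integrable lborel (\<lambda>x::'a. indicat_real (ball 0 R) x)"
  using emeasure_bounded_finite[OF bounded_ball, of "0::'a" R] by (simp add: infinity_ennreal_def)

lemma integral_v_le: "(LINT x|lborel. \<bar>v j x\<bar>) \<le> vol"
proof -
  have "(LINT x|lborel. \<bar>v j x\<bar> * 1) \<le> (LINT x|lborel. indicat_real (ball (0::'a) R) x)"
  proof (rule integral_mono[OF Cc_infty_integrals(1)[OF Cc R one] integrable_ball])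
    fix x :: 'a
    show "\<bar>v j x\<bar> * 1 \<le> indicat_real (ball 0 R) x"
      using le_1[of j x] nonneg[of j x] Cc_infty_outside(1)[OF Cc[of j] R, of x] by (auto simp: indicator_def)
  qed
  then show ?thesis by (simp add: vol_def)
qed

lemma integral_v_tendsto: "(\<lambda>j. LINT x|lborel. \<bar>v j x\<bar>) \<longlonglongrightarrow> vol"
proof -
  have "(\<lambda>j. LINT x|lborel. \<bar>v j x\<bar>) \<longlonglongrightarrow> (LINT x|lborel. indicat_real (ball (0::'a) R) x)"
  proof (rule integral_dominated_convergence[where w = "indicat_real (ball 0 R)"])
    show "(\<lambda>x. \<bar>v j x\<bar>) \<in> borel_measurable lborel" for j
      using Cc_infty_integrals(1)[OF Cc R one] by simp
    show "AE x in lborel. (\<lambda>j. \<bar>v j x\<bar>) \<longlonglongrightarrow> indicat_real (ball 0 R) x"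
    proof (rule AE_I2)
      fix x :: 'a
      show "(\<lambda>j. \<bar>v j x\<bar>) \<longlonglongrightarrow> indicat_real (ball 0 R) x"
      proof (cases "norm x < R")
        case True
        then show ?thesis using tendsto_rabs[OF lim[OF True]] by simp
      next
        case False
        then show ?thesis using Cc_infty_outside(1)[OF Cc R, of x] by simp
      qed
    qed
    show "AE x in lborel. norm \<bar>v j x\<bar> \<le> indicat_real (ball 0 R) x" for j
    proof (rule AE_I2)
      fix x :: 'a
      show "norm \<bar>v j x\<bar> \<le> indicat_real (ball 0 R) x"
        using le_1[of j x] nonneg[of j x] Cc_infty_outside(1)[OF Cc[of j] R, of x] by (auto simp: indicator_def)
    qed
  qed (use integrable_ball in auto)
  then show ?thesis by (simp add: vol_def)
qed

text \<open>The divergence theorem for the field x, whose divergence is the dimension. It yields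
  upper bounds for the total gradient as well as the lower bound that makes the logarithmic integral
  diverge.\<close>

lemma integral_radial_derivative:
  "(LINT x|lborel. \<bar>grad (v j) x \<bullet> x\<bar>) = real DIM('a) * (LINT x|lborel. \<bar>v j x\<bar>)"
proof -
  have "(LINT x|lborel. \<bar>v j x\<bar> * (1 + (real DIM('a) - 1) * (norm x / norm x))) =
     (LINT x|lborel. \<bar>grad (v j) x \<bullet> x\<bar> * (norm x / norm x))"
    by (rule radial_divergence(2)[OF Cc R, where f = "\<lambda>r. r" and f' = "\<lambda>_. 1"]) (use mono one in auto)
  also have "(LINT x|lborel. \<bar>v j x\<bar> * (1 + (real DIM('a) - 1) * (norm x / norm x))) =
      (LINT x|lborel. real DIM('a) * \<bar>v j x\<bar>)"
  \<comment> \<open>The quotient \<open>norm x / norm x\<close> is 0 at the origin, so the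
    integrands agree only almost everywhere.\<close>
  proof (rule integral_cong_AE)
    have "AE x in lborel. x \<noteq> (0::'a)" by (rule AE_lborel_singleton)
    then show "AE x in lborel. \<bar>v j x\<bar> * (1 + (real DIM('a) - 1) * (norm x / norm x)) = real DIM('a) * \<bar>v j x\<bar>"
      by eventually_elim simp
    have [measurable]: "(\<lambda>x. \<bar>v j x\<bar>) \<in> borel_measurable borel"
      using Cc_infty_integrals(1)[OF Cc R one, of j] by (auto dest: borel_measurable_integrable)
    show "(\<lambda>x. \<bar>v j x\<bar> * (1 + (real DIM('a) - 1) * (norm x / norm x))) \<in> borel_measurable lborel"
      "(\<lambda>x. real DIM('a) * \<bar>v j x\<bar>) \<in> borel_measurable lborel" by measurable
  qed
  also have "(\<lambda>x. \<bar>grad (v j) x \<bullet> x\<bar> * (norm x / norm x)) = (\<lambda>x. \<bar>grad (v j) x \<bullet> x\<bar>)"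
    by (auto simp: fun_eq_iff)
  finally show ?thesis by simp
qed

text \<open>For R / 2 < \<bar>x\<bar> the gradient is at most 2 / R times the radial expression,
  whose integral is at most the dimension times \<open>vol\<close>; on the inner ball it is
  eventually at most 1. This keeps the error term of \<open>Im_le\<close> bounded.\<close>

lemma integral_grad_bounded:
  "\<forall>\<^sub>F j in sequentially. (LINT x|lborel. norm (grad (v j) x)) \<le> 2 * real DIM('a) * vol / R + vol"
proof -
  have "\<forall>\<^sub>F j in sequentially. \<forall>x. norm x \<le> R / 2 \<longrightarrow> norm (grad (v j) x) \<le> 1"
    by (rule grad_small) (use R in auto)
  then show ?thesis
  proof eventually_elim
    case (elim j)
    have i: "integrable lborel (\<lambda>x. \<bar>grad (v j) x \<bullet> x\<bar>)"
      using Cc_infty_integrals(5)[OF Cc R one, of j] by simp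
    have "(LINT x|lborel. norm (grad (v j) x) * 1) \<le>
       (LINT x|lborel. 2 / R * \<bar>grad (v j) x \<bullet> x\<bar> + indicat_real (ball 0 R) x)"
    proof (rule integral_mono[OF Cc_infty_integrals(3)[OF Cc R one]])
      show "integrable lborel (\<lambda>x. 2 / R * \<bar>grad (v j) x \<bullet> x\<bar> + indicat_real (ball 0 R) x)"
        using i integrable_ball by (intro Bochner_Integration.integrable_add integrable_mult_right)
      fix x :: 'a
      consider "norm x \<le> R / 2" | "R / 2 < norm x" "norm x < R" | "R \<le> norm x" by linarith
      then show "norm (grad (v j) x) * 1 \<le> 2 / R * \<bar>grad (v j) x \<bullet> x\<bar> + indicat_real (ball 0 R) x"
      proof cases
        case 1
        then have "norm (grad (v j) x) \<le> 1" using elim by blast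
        moreover have "0 \<le> 2 / R * \<bar>grad (v j) x \<bullet> x\<bar>" using R by simp
        moreover have "x \<in> ball 0 R" using 1 R by simp
        ultimately show ?thesis by simp
      next
        case 2
        then have "norm (grad (v j) x) * 1 \<le> norm (grad (v j) x) * (2 / R * norm x)"
          using R by (intro mult_left_mono) (auto simp: field_simps)
        then show ?thesis unfolding radial by (simp add: indicator_def mult_ac)
      next
        case 3
        then show ?thesis using Cc_infty_outside(2)[OF Cc[of j] R] by simp
      qed
    qed
    also have "\<dots> = 2 / R * (real DIM('a) * (LINT x|lborel. \<bar>v j x\<bar>)) + vol"
      using i integrable_ball by (simp add: vol_def integral_radial_derivative)
    also have "\<dots> \<le> 2 / R * (real DIM('a) * vol) + vol"
      using R integral_v_le[of j] by (intro add_right_mono mult_left_mono) auto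
    finally show ?case by (simp add: field_simps)
  qed
qed

text \<open>On these functions the divergence theorem and Cauchy-Schwarz are equalities, so for
  \<open>\<gamma> = 1\<close> the only loss is the constant \<open>R powr (1 - s)\<close> subtracted
  in the field. What remains of \<open>Im\<close> is the integral of \<bar>v j\<bar> against the
  remainder in \<open>sum_weight_eq\<close>.\<close>

lemma Im_le:
  assumes s: "1 \<le> s" and W: "loc_bounded R W"
    and le: "\<And>r. 0 < r \<Longrightarrow> r < R \<Longrightarrow> (real DIM('a) - 1) *
       (((R - r) powr (real m + 1 - s) - R powr (real m + 1 - s)) / (r * R ^ m)) \<le> a * W r + C"
  shows "Im R s m (v j) \<le> a * (LINT x|lborel. \<bar>v j x\<bar> * W (norm x)) + C * (LINT x|lborel. \<bar>v j x\<bar>)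
           + R powr (1 - s) * (LINT x|lborel. norm (grad (v j) x))"
proof -
  define N where "N = real DIM('a) - 1"
  define S where "S = sum_weight R N s m"
  define F where "F = hardy_field R s 1"
  define F' where "F' = hardy_field' R s 1"
  have lf: "loc_bounded R (\<lambda>r. F r / r)" unfolding F_def
    by (rule loc_bounded_quotient[OF hardy_field_0[OF R] hardy_field_derivative hardy_field_measurable loc_bounded_hardy_field'])
  have lS: "loc_bounded R S" unfolding S_def by (rule loc_bounded_sum_weight)
  have lD: "loc_bounded R (\<lambda>r. F' r + N * (F r / r))"
    unfolding F'_def by (intro loc_bounded_add loc_bounded_cmult lf loc_bounded_hardy_field')
  have lW: "loc_bounded R (\<lambda>r. a * W r + C * 1)"
    by (intro loc_bounded_add loc_bounded_cmult W one)
  note iD = Cc_infty_integrals(1)[OF Cc[of j] R lD]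
  note iS = Cc_infty_integrals(1)[OF Cc[of j] R lS]
  note iW = Cc_infty_integrals(1)[OF Cc[of j] R W]
  note i1 = Cc_infty_integrals(1)[OF Cc[of j] R one]
  note iG = Cc_infty_integrals(3)[OF Cc[of j] R loc_bounded_powr]
  note ig = Cc_infty_integrals(3)[OF Cc[of j] R one]
  have "(LINT x|lborel. \<bar>v j x\<bar> * (F' (norm x) + N * (F (norm x) / norm x))) =
    (LINT x|lborel. \<bar>grad (v j) x \<bullet> x\<bar> * (F (norm x) / norm x))"
    unfolding F_def F'_def N_def using s mono
    by (intro radial_divergence(2)[OF Cc R hardy_field_0[OF R] hardy_field_derivative hardy_field_measurable loc_bounded_hardy_field' hardy_field_nonneg]) auto
  also have "\<dots> = (LINT x|lborel. norm (grad (v j) x) * (R - norm x) powr (1 - s) - R powr (1 - s) * (norm (grad (v j) x) * 1))"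
  proof (rule Bochner_Integration.integral_cong[OF refl])
    fix x
    show "\<bar>grad (v j) x \<bullet> x\<bar> * (F (norm x) / norm x) = norm (grad (v j) x) * (R - norm x) powr (1 - s) - R powr (1 - s) * (norm (grad (v j) x) * 1)"
    proof (cases "x \<noteq> 0 \<and> norm x < R")
      case True
      then have h1: "F (norm x) = (R - norm x) powr (1 - s) - R powr (1 - s)"
        using Xf_pos[of "norm x" R] by (simp add: F_def hardy_field_def)
      have h2: "\<bar>grad (v j) x \<bullet> x\<bar> * (F (norm x) / norm x) = norm (grad (v j) x) * F (norm x)"
        using True unfolding radial by simp
      show ?thesis unfolding h2 unfolding h1 by (simp add: algebra_simps)
    next
      case False
      then show ?thesis using Cc_infty_outside(2)[OF Cc[of j] R, of x] by auto
    qed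
  qed
  also have "\<dots> = (LINT x|lborel. norm (grad (v j) x) * (R - norm x) powr (1 - s)) - R powr (1 - s) * (LINT x|lborel. norm (grad (v j) x))"
    using iG ig by simp
  finally have G: "(LINT x|lborel. \<bar>v j x\<bar> * (F' (norm x) + N * (F (norm x) / norm x))) = \<dots>" .
  have "(LINT x|lborel. \<bar>v j x\<bar> * (F' (norm x) + N * (F (norm x) / norm x))) - (LINT x|lborel. \<bar>v j x\<bar> * S (norm x)) =
     (LINT x|lborel. \<bar>v j x\<bar> * (F' (norm x) + N * (F (norm x) / norm x)) - \<bar>v j x\<bar> * S (norm x))"
    by (simp only: Bochner_Integration.integral_diff[OF iD iS])
  also have "\<dots> \<le> (LINT x|lborel. \<bar>v j x\<bar> * (a * W (norm x) + C * 1))"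
  proof (rule integral_mono_AE[OF _ Cc_infty_integrals(1)[OF Cc[of j] R lW]])
    show "integrable lborel (\<lambda>x. \<bar>v j x\<bar> * (F' (norm x) + N * (F (norm x) / norm x)) - \<bar>v j x\<bar> * S (norm x))"
      by (rule Bochner_Integration.integrable_diff[OF iD iS])
    have "AE x in lborel. x \<noteq> (0::'a)" by (rule AE_lborel_singleton)
    then show "AE x in lborel. \<bar>v j x\<bar> * (F' (norm x) + N * (F (norm x) / norm x)) - \<bar>v j x\<bar> * S (norm x)
      \<le> \<bar>v j x\<bar> * (a * W (norm x) + C * 1)"
    proof eventually_elim
      case (elim x)
      show ?case
      proof (cases "norm x < R")
        case True
        then have "F' (norm x) + N * (F (norm x) / norm x) - S (norm x) \<le> a * W (norm x) + C * 1"
          using sum_weight_eq[of "norm x" R s N m] le[of "norm x"] elim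
          by (simp add: F_def F'_def S_def N_def)
        then show ?thesis unfolding right_diff_distrib[symmetric] by (intro mult_left_mono) auto
      next
        case False
        then show ?thesis using Cc_infty_outside(1)[OF Cc[of j] R, of x] by simp
      qed
    qed
  qed
  also have "\<dots> = (LINT x|lborel. a * (\<bar>v j x\<bar> * W (norm x)) + C * (\<bar>v j x\<bar> * 1))"
    by (rule Bochner_Integration.integral_cong) (auto simp: algebra_simps)
  also have "\<dots> = a * (LINT x|lborel. \<bar>v j x\<bar> * W (norm x)) + C * (LINT x|lborel. \<bar>v j x\<bar>)"
    using Bochner_Integration.integral_add[OF integrable_mult_right[OF iW, of a] integrable_mult_right[OF i1, of C]] by simp
  finally show ?thesis
    using G unfolding Im_eq[OF Cc R] S_def N_def by linarith
qed


text \<open>Tested with the radial field of size \<open>f = ln (1 - ln (d / R))\<close>, whose derivative is the weight and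
  which is unbounded at the sphere, where the gradients of the exhausting functions concentrate.\<close>

lemma integral_log_weight_at_top:
  "filterlim (\<lambda>j. LINT x|lborel. \<bar>v j x\<bar> * (Xf ((R - norm x) / R) / (R - norm x))) at_top sequentially"
proof -
  define n where "n = real DIM('a)"
  have n: "n \<ge> 1" using DIM_positive[where 'a='a] unfolding n_def by simp
  define f where "f = (\<lambda>r. ln (1 - ln ((R - r) / R)))"
  define f' where "f' = (\<lambda>r. Xf ((R - r) / R) / (R - r))"
  have f0: "f 0 = 0" using R by (simp add: f_def)
  have L: "0 < 1 - ln ((R - r) / R)" if "0 \<le> r" "r < R" for r
    using log_term_ge_1[OF that] by linarith
  have der: "(f has_real_derivative f' r) (at r)" if r: "0 \<le> r" "r < R" for r
  proof -
    have "((\<lambda>r. 1 - ln ((R - r) / R)) has_real_derivative 1 / (R - r)) (at r)"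
      using r by (auto intro!: derivative_eq_intros simp: field_simps)
    from DERIV_chain2[OF DERIV_ln_divide[OF L[OF r]] this] show ?thesis
      unfolding f_def f'_def Xf_def by simp
  qed
  have fm: "f \<in> borel_measurable borel" unfolding f_def by measurable
  have lf': "loc_bounded R f'" unfolding f'_def by (rule loc_bounded_Xf)
  have fpos: "0 \<le> f r" if "0 \<le> r" "r < R" for r
    unfolding f_def using log_term_ge_1[OF that] by (rule ln_ge_zero)
  have fmono: "f r \<le> f t" if "0 \<le> r" "r \<le> t" "t < R" for r t
  proof -
    have "(R - t) / R \<le> (R - r) / R" "0 < (R - t) / R" using that R by (auto intro: divide_right_mono)
    then have "ln ((R - t) / R) \<le> ln ((R - r) / R)" by (simp add: ln_mono)
    moreover have "0 < 1 - ln ((R - r) / R)" using that by (intro L) auto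
    ultimately show ?thesis unfolding f_def by (intro ln_mono) linarith+
  qed
  \<comment> \<open>This lets \<open>f'\<close> alone dominate the divergence, by the factor 2 n. In
    the variable y = - ln (d / R) it follows from ln (1 + y) \<le> y and y (1 + y) \<le> 2 (exp y -
    1), where exp y - 1 = r / (R - r).\<close>
  have quot: "f r / r \<le> 2 * f' r" if r: "0 < r" "r < R" for r
  proof -
    define y where "y = - ln ((R - r) / R)"
    have y: "0 \<le> y" using log_term_ge_1[of r R] r by (simp add: y_def)
    have ey: "exp y = R / (R - r)" using r by (simp add: y_def exp_minus)
    have "f r = ln (1 + y)" by (simp add: f_def y_def)
    then have "f r * (1 + y) \<le> y * (1 + y)"
      using y ln_add_one_self_le_self[OF y] by (intro mult_right_mono) auto
    also have "\<dots> \<le> 2 * (exp y - 1)" using exp_lower_Taylor_quadratic[OF y] y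
      by (simp add: algebra_simps power2_eq_square)
    also have "\<dots> = 2 * r / (R - r)" unfolding ey using r by (simp add: field_simps)
    finally have "f r \<le> 2 * r / (R - r) / (1 + y)" using y by (subst pos_le_divide_eq) auto
    then have "f r / r \<le> 2 * r / (R - r) / (1 + y) / r" using r by (intro divide_right_mono) auto
    also have "\<dots> = 2 * f' r" using r by (simp add: f'_def Xf_def y_def)
    finally show ?thesis .
  qed
  have f'pos: "0 \<le> f' r" if "0 \<le> r" "r < R" for r
    using Xf_pos[OF that] that by (simp add: f'_def)
  note lq = loc_bounded_quotient[OF f0 der fm lf']
  have lD: "loc_bounded R (\<lambda>r. f' r + (n - 1) * (f r / r))"
    by (intro loc_bounded_add loc_bounded_cmult lf' lq)
  have upper: "(LINT x|lborel. \<bar>grad (v j) x \<bullet> x\<bar> * (f (norm x) / norm x)) \<le> 2 * n * (LINT x|lborel. \<bar>v j x\<bar> * f' (norm x))" for j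
  proof -
    have "(LINT x|lborel. \<bar>v j x\<bar> * (f' (norm x) + (n - 1) * (f (norm x) / norm x))) =
       (LINT x|lborel. \<bar>grad (v j) x \<bullet> x\<bar> * (f (norm x) / norm x))"
      unfolding n_def using mono by (intro radial_divergence(2)[OF Cc R f0 der fm lf' fpos]) auto
    moreover have "(LINT x|lborel. \<bar>v j x\<bar> * (f' (norm x) + (n - 1) * (f (norm x) / norm x))) \<le>
       (LINT x|lborel. \<bar>v j x\<bar> * ((2 * n) * f' (norm x)))"
    proof (rule integral_mono[OF Cc_infty_integrals(1)[OF Cc R lD] Cc_infty_integrals(1)[OF Cc R loc_bounded_cmult[OF lf']]])
      fix x :: 'a
      show "\<bar>v j x\<bar> * (f' (norm x) + (n - 1) * (f (norm x) / norm x)) \<le> \<bar>v j x\<bar> * ((2 * n) * f' (norm x))"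
      proof (cases "norm x < R")
        case True
        have "f (norm x) / norm x \<le> 2 * f' (norm x)"
          using quot[of "norm x"] f'pos[of "norm x"] True by (cases "x = 0") auto
        then have "(n - 1) * (f (norm x) / norm x) \<le> (n - 1) * (2 * f' (norm x))"
          using n by (intro mult_left_mono) auto
        then have "f' (norm x) + (n - 1) * (f (norm x) / norm x) \<le> (2 * n) * f' (norm x)"
          using f'pos[of "norm x"] True by (simp add: algebra_simps)
        then show ?thesis by (intro mult_left_mono) auto
      next
        case False
        then show ?thesis using Cc_infty_outside(1)[OF Cc[of j] R, of x] by simp
      qed
    qed
    moreover have "(LINT x|lborel. \<bar>v j x\<bar> * ((2 * n) * f' (norm x))) = 2 * n * (LINT x|lborel. \<bar>v j x\<bar> * f' (norm x))"
      by (simp only: mult.left_commute[of _ "2 * n"] integral_mult_right_zero)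
    ultimately show ?thesis by linarith
  qed
  have lower: "\<forall>\<^sub>F j in sequentially. K * vol / (8 * R) \<le> (LINT x|lborel. \<bar>v j x\<bar> * f' (norm x))" if K: "K > 0" for K
  proof -
    \<comment> \<open>The solution of \<open>f r0 = K\<close>; beyond this radius the field has size
      at least \<open>K\<close>.\<close>
    define r0 where "r0 = R * (1 - exp (1 - exp K))"
    have "exp (1 - exp K) < 1" "1 \<le> exp K" using K by auto
    then have r0: "0 \<le> r0" "r0 < R" using R by (auto simp: r0_def algebra_simps)
    have "(R - r0) / R = exp (1 - exp K)" using R by (simp add: r0_def field_simps)
    then have fr0: "f r0 = K" by (simp add: f_def)
    \<comment> \<open>The loss e R vol = n vol / 4 then uses up half of the lower bound n vol / 2
      for the integral of the radial expression. Dividing the other half by 2 n gives the constant 8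
      in the claim.\<close>
    define e where "e = n / (4 * R)"
    have e: "e > 0" using n R by (simp add: e_def)
    have "\<forall>\<^sub>F j in sequentially. vol / 2 < (LINT x|lborel. \<bar>v j x\<bar>)"
      using integral_v_tendsto by (rule order_tendstoD) (use vol_pos in simp)
    with grad_small[OF r0(2) e] show ?thesis
    proof eventually_elim
      case (elim j)
      have i: "integrable lborel (\<lambda>x. \<bar>grad (v j) x \<bullet> x\<bar>)"
        using Cc_infty_integrals(5)[OF Cc R one, of j] by simp
      have i': "integrable lborel (\<lambda>x. K / R * (\<bar>grad (v j) x \<bullet> x\<bar> - e * R * indicat_real (ball 0 R) x))"
        using i integrable_ball by (intro integrable_mult_right Bochner_Integration.integrable_diff)
      have "K / R * (n * (vol / 2) - e * R * vol) \<le> K / R * (n * (LINT x|lborel. \<bar>v j x\<bar>) - e * R * vol)"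
        using elim K R n by (intro mult_left_mono diff_right_mono) auto
      also have "\<dots> = (LINT x|lborel. K / R * (\<bar>grad (v j) x \<bullet> x\<bar> - e * R * indicat_real (ball 0 R) x))"
        using i integrable_ball by (simp add: integral_radial_derivative n_def vol_def)
      also have "\<dots> \<le> (LINT x|lborel. \<bar>grad (v j) x \<bullet> x\<bar> * (f (norm x) / norm x))"
      proof (rule integral_mono[OF i' Cc_infty_integrals(5)[OF Cc R lq]])
        fix x :: 'a
        consider "norm x \<le> r0" | "r0 < norm x" "norm x < R" | "R \<le> norm x" by linarith
        then show "K / R * (\<bar>grad (v j) x \<bullet> x\<bar> - e * R * indicat_real (ball 0 R) x) \<le> \<bar>grad (v j) x \<bullet> x\<bar> * (f (norm x) / norm x)"
        proof cases
          case 1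
          then have "\<bar>grad (v j) x \<bullet> x\<bar> \<le> e * R"
            unfolding radial using elim r0 e by (intro mult_mono) auto
          moreover have "x \<in> ball 0 R" using 1 r0 by simp
          ultimately have "K / R * (\<bar>grad (v j) x \<bullet> x\<bar> - e * R * indicat_real (ball 0 R) x) \<le> 0"
            using K R by (intro mult_nonneg_nonpos) auto
          also have "0 \<le> \<bar>grad (v j) x \<bullet> x\<bar> * (f (norm x) / norm x)"
            using fpos[of "norm x"] 1 r0 by simp
          finally show ?thesis .
        next
          case 2
          have "K / R * (\<bar>grad (v j) x \<bullet> x\<bar> - e * R * indicat_real (ball 0 R) x) \<le> K / R * \<bar>grad (v j) x \<bullet> x\<bar>"
            using K R e by (intro mult_left_mono) (auto simp: indicator_def)
          also have "K / R \<le> f (norm x) / norm x"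
            using fmono[of r0 "norm x"] 2 r0 fr0 K R by (intro frac_le) auto
          then have "K / R * \<bar>grad (v j) x \<bullet> x\<bar> \<le> \<bar>grad (v j) x \<bullet> x\<bar> * (f (norm x) / norm x)"
            by (subst mult.commute) (rule mult_left_mono, auto)
          finally show ?thesis .
        next
          case 3
          then show ?thesis using Cc_infty_outside(2)[OF Cc[of j] R, of x] by simp
        qed
      qed
      also have "\<dots> \<le> 2 * n * (LINT x|lborel. \<bar>v j x\<bar> * f' (norm x))" by (rule upper)
      also have "K / R * (n * (vol / 2) - e * R * vol) = 2 * n * (K * vol / (8 * R))"
        using R by (simp add: e_def field_simps)
      finally show ?case by (rule mult_left_le_imp_le) (use n in simp)
    qed
  qed
  show ?thesis
    unfolding filterlim_at_top_gt[of _ _ 0]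
  proof (intro allI impI)
    fix Z :: real assume Z: "Z > 0"
    have "Z * 8 * R / vol * vol / (8 * R) = Z" using vol_pos R by simp
    then show "\<forall>\<^sub>F j in sequentially. Z \<le> (LINT x|lborel. \<bar>v j x\<bar> * (Xf ((R - norm x) / R) / (R - norm x)))"
      using lower[of "Z * 8 * R / vol"] Z vol_pos R unfolding f'_def by simp
  qed
qed

text \<open>The remainder is compared with \<open>W\<close> only near the sphere. Its part away from
  the sphere and the gradient error together cost a constant \<open>A\<close>, which is negligible
  because \<open>W\<close> dominates a multiple of X / d and hence its integrals against
  \<open>v j\<close> tend to infinity.\<close>

lemma near_optimal:
  assumes s: "real m + 1 \<le> s" and W: "loc_bounded R W"
    and c0: "c0 > 0" "\<And>r. 0 \<le> r \<Longrightarrow> r < R \<Longrightarrow> c0 * (Xf ((R - r) / R) / (R - r)) \<le> W r"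
    and L: "L \<ge> 0"
    and le: "\<And>e. e > 0 \<Longrightarrow> \<forall>\<^sub>F r in at_left R.
       (real DIM('a) - 1) * ((R - r) powr (real m + 1 - s) / (r * R ^ m)) \<le> (L + e) * W r"
    and e: "e > 0"
  shows "\<exists>j. v j \<noteq> (\<lambda>x. 0) \<and> Im R s m (v j) / (LINT x|lborel. \<bar>v j x\<bar> * W (norm x)) \<le> L + e"
proof -
  define N where "N = real DIM('a) - 1"
  have N: "N \<ge> 0" using DIM_positive[where 'a='a] unfolding N_def by simp
  define Q where "Q = (\<lambda>r. N * (((R - r) powr (real m + 1 - s) - R powr (real m + 1 - s)) / (r * R ^ m)))"
  have Wpos: "0 \<le> W r" if "0 \<le> r" "r < R" for r
    using c0(2)[OF that] Xf_pos[OF that] c0(1) that by (meson diff_ge_0_iff_ge divide_nonneg_nonneg less_imp_le mult_nonneg_nonneg order_trans)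
  obtain b where b: "b < R" "\<And>r. b < r \<Longrightarrow> r < R \<Longrightarrow> N * ((R - r) powr (real m + 1 - s) / (r * R ^ m)) \<le> (L + e / 2) * W r"
    using le[of "e / 2"] e unfolding eventually_at_left_field N_def by auto
  \<comment> \<open>\<open>Q\<close> has \<open>r\<close> in its denominator;
    \<open>sum_weight_eq\<close> rewrites it as this difference of locally bounded functions, which
    bounds it up to the origin.\<close>
  have "loc_bounded R (\<lambda>r. (hardy_field' R s 1 r + N * (hardy_field R s 1 r / r)) + (- 1) * sum_weight R N s m r)"
    by (intro loc_bounded_add loc_bounded_cmult loc_bounded_hardy_field' loc_bounded_sum_weight
       loc_bounded_quotient[OF hardy_field_0[OF R] hardy_field_derivative hardy_field_measurable loc_bounded_hardy_field'])
  then obtain M where M: "\<And>r. 0 \<le> r \<Longrightarrow> r \<le> b \<Longrightarrow> \<bar>(hardy_field' R s 1 r + N * (hardy_field R s 1 r / r)) + (- 1) * sum_weight R N s m r\<bar> \<le> M"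
    unfolding loc_bounded_def using b(1) by blast
  define C where "C = \<bar>M\<bar>"
  have QC: "Q r \<le> (L + e / 2) * W r + C" if r: "0 < r" "r < R" for r
  proof (cases "r \<le> b")
    case True
    have "Q r = (hardy_field' R s 1 r + N * (hardy_field R s 1 r / r)) + (- 1) * sum_weight R N s m r"
      unfolding Q_def using sum_weight_eq[OF r, of s N m] by simp
    then have "Q r \<le> M" using M[of r] r True by linarith
    moreover have "0 \<le> (L + e / 2) * W r" using Wpos[of r] r L e by simp
    ultimately show ?thesis unfolding C_def by linarith
  next
    case False
    have "Q r \<le> N * ((R - r) powr (real m + 1 - s) / (r * R ^ m))"
      unfolding Q_def using N r by (intro mult_left_mono divide_right_mono) auto
    also have "\<dots> \<le> (L + e / 2) * W r" using b(2) False r by simp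
    finally show ?thesis by (simp add: C_def)
  qed
  define A where "A = C * vol + R powr (1 - s) * (2 * real DIM('a) * vol / R + vol)"
  have A: "A \<ge> 0" unfolding A_def C_def using vol_pos R by simp
  define J where "J = (\<lambda>j. LINT x|lborel. \<bar>v j x\<bar> * W (norm x))"
  \<comment> \<open>The threshold forces \<open>J j \<ge> 2 * A / e + 1\<close>: the first term
    absorbs \<open>A\<close> into \<open>e / 2 * J j\<close>, and the 1 keeps \<open>J j\<close>
    positive even if \<open>A\<close> is 0.\<close>
  have "\<forall>\<^sub>F j in sequentially. (2 * A / e + 1) / c0 \<le> (LINT x|lborel. \<bar>v j x\<bar> * (Xf ((R - norm x) / R) / (R - norm x)))"
    using integral_log_weight_at_top unfolding filterlim_at_top by blast
  with integral_grad_bounded have "\<forall>\<^sub>F j in sequentially. v j \<noteq> (\<lambda>x. 0) \<and> Im R s m (v j) / J j \<le> L + e"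
  proof eventually_elim
    case (elim j)
    have "2 * A / e + 1 \<le> c0 * (LINT x|lborel. \<bar>v j x\<bar> * (Xf ((R - norm x) / R) / (R - norm x)))"
      using elim(2) c0(1) by (simp only: pos_divide_le_eq mult.commute)
    also have "\<dots> = (LINT x|lborel. \<bar>v j x\<bar> * (c0 * (Xf ((R - norm x) / R) / (R - norm x))))"
      by (simp only: mult.left_commute[of _ c0] integral_mult_right_zero)
    also have "\<dots> \<le> J j" unfolding J_def
    proof (rule integral_mono[OF Cc_infty_integrals(1)[OF Cc R loc_bounded_cmult[OF loc_bounded_Xf]] Cc_infty_integrals(1)[OF Cc R W]])
      fix x :: 'a
      show "\<bar>v j x\<bar> * (c0 * (Xf ((R - norm x) / R) / (R - norm x))) \<le> \<bar>v j x\<bar> * W (norm x)"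
      proof (cases "norm x < R")
        case True
        then show ?thesis by (intro mult_left_mono c0(2)) auto
      next
        case False
        then show ?thesis using Cc_infty_outside(1)[OF Cc[of j] R, of x] by simp
      qed
    qed
    finally have J: "2 * A / e + 1 \<le> J j" .
    moreover have "0 \<le> 2 * A / e" using A e by simp
    ultimately have Jpos: "J j > 0" and "2 * A / e \<le> J j" by linarith+
    then have AJ: "A \<le> e / 2 * J j" using e by (simp add: field_simps)
    have "Im R s m (v j) \<le> (L + e / 2) * J j + C * (LINT x|lborel. \<bar>v j x\<bar>)
           + R powr (1 - s) * (LINT x|lborel. norm (grad (v j) x))"
      unfolding J_def by (rule Im_le) (use QC s W in \<open>auto simp: Q_def N_def\<close>)
    also have "\<dots> \<le> (L + e / 2) * J j + C * vol + R powr (1 - s) * (2 * real DIM('a) * vol / R + vol)"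
      using elim(1) integral_v_le[of j] L e by (intro add_mono mult_left_mono) (auto simp: C_def)
    also have "\<dots> = (L + e / 2) * J j + A" by (simp add: A_def)
    also have "\<dots> \<le> (L + e / 2) * J j + e / 2 * J j" using AJ by simp
    also have "\<dots> = (L + e) * J j" by (simp add: algebra_simps)
    finally have "Im R s m (v j) / J j \<le> L + e" using Jpos by (simp add: pos_divide_le_eq)
    moreover have "v j \<noteq> (\<lambda>x. 0)"
    proof
      assume "v j = (\<lambda>x. 0)"
      then have "J j = 0" by (simp add: J_def)
      then show False using Jpos by simp
    qed
    ultimately show ?case by blast
  qed
  from eventually_happens'[OF sequentially_bot this] show ?thesis unfolding J_def .
qed

end

section \<open>The infima of the quotients\<close>

lemma INF_ereal_eqI:
  fixes q :: "'b \<Rightarrow> real"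
  assumes "\<And>u. u \<in> S \<Longrightarrow> L \<le> q u" "\<And>e. e > 0 \<Longrightarrow> \<exists>u\<in>S. q u \<le> L + e"
  shows "(INF u\<in>S. ereal (q u)) = ereal L"
proof (rule antisym)
  show "ereal L \<le> (INF u\<in>S. ereal (q u))" using assms(1) by (intro INF_greatest) simp
  show "(INF u\<in>S. ereal (q u)) \<le> ereal L"
  proof (rule ereal_le_epsilon2)
    fix e :: real assume "e > 0"
    then obtain u where "u \<in> S" "q u \<le> L + e" using assms(2) by blast
    then show "(INF u\<in>S. ereal (q u)) \<le> ereal L + ereal e"
      by (intro INF_lower2[of u]) auto
  qed
qed

text \<open>A nonzero continuous function is nonzero on a nonempty open set, which is not
  negligible. So the denominators in the infima are positive and no quotient is a division by
  zero.\<close>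

lemma integral_abs_pos:
  fixes u :: "'a::euclidean_space \<Rightarrow> real"
  assumes u: "Cc_infty R u" and R: "R > 0" and nz: "u \<noteq> (\<lambda>x. 0)"
    and k: "loc_bounded R k" "\<And>r. 0 \<le> r \<Longrightarrow> r < R \<Longrightarrow> 0 < k r"
  shows "0 < (LINT x|lborel. \<bar>u x\<bar> * k (norm x))"
proof -
  note out = Cc_infty_outside(1)[OF u R]
  have nn: "0 \<le> \<bar>u x\<bar> * k (norm x)" for x
    using k(2)[of "norm x"] out[of x] by (cases "norm x < R") auto
  have "(LINT x|lborel. \<bar>u x\<bar> * k (norm x)) \<noteq> 0"
  proof
    assume "(LINT x|lborel. \<bar>u x\<bar> * k (norm x)) = 0"
    then have "AE x in lborel. \<bar>u x\<bar> * k (norm x) = 0"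
      using integral_nonneg_eq_0_iff_AE[OF Cc_infty_integrals(1)[OF u R k(1)]] nn by simp
    then have "AE x in lborel. x \<notin> {x. u x \<noteq> 0}"
    proof eventually_elim
      case (elim x)
      then show ?case using k(2)[of "norm x"] out[of x] by (cases "norm x < R") auto
    qed
    moreover have op: "open {x. u x \<noteq> 0}"
      using Cc_infty_continuous[OF u R] by (intro open_Collect_neq) auto
    ultimately have "{x. u x \<noteq> 0} \<in> null_sets lborel"
      by (subst AE_iff_null_sets) auto
    then have "negligible {x. u x \<noteq> 0}"
      by (simp add: negligible_iff_null_sets null_sets_completionI)
    then have "{x. u x \<noteq> 0} = {}" using open_not_negligible[OF op] by blast
    then show False using nz by auto
  qed
  moreover have "0 \<le> (LINT x|lborel. \<bar>u x\<bar> * k (norm x))" using nn by simp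
  ultimately show ?thesis by linarith
qed

lemma near_optimal_exists:
  assumes R: "R > 0" and s: "real m + 1 \<le> s" and W: "loc_bounded R W"
    and c0: "c0 > 0" "\<And>r. 0 \<le> r \<Longrightarrow> r < R \<Longrightarrow> c0 * (Xf ((R - r) / R) / (R - r)) \<le> W r"
    and L: "L \<ge> 0"
    and le: "\<And>e. e > 0 \<Longrightarrow> \<forall>\<^sub>F r in at_left R.
       (real DIM('a) - 1) * ((R - r) powr (real m + 1 - s) / (r * R ^ m)) \<le> (L + e) * W r"
    and e: "e > 0"
  shows "\<exists>u::'a::euclidean_space \<Rightarrow> real. Cc_infty R u \<and> u \<noteq> (\<lambda>x. 0) \<and>
     Im R s m u / (LINT x|lborel. \<bar>u x\<bar> * W (norm x)) \<le> L + e"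
proof -
  obtain v :: "nat \<Rightarrow> 'a \<Rightarrow> real" where v: "\<And>j. Cc_infty R (v j)" "\<And>j x. v j x \<le> 1"
    "\<And>j x y. norm x \<le> norm y \<Longrightarrow> 0 \<le> v j y \<and> v j y \<le> v j x"
    "\<And>x. norm x < R \<Longrightarrow> (\<lambda>j. v j x) \<longlonglongrightarrow> 1"
    "\<And>j x. \<bar>grad (v j) x \<bullet> x\<bar> = norm (grad (v j) x) * norm x"
    "\<And>r e. r < R \<Longrightarrow> e > 0 \<Longrightarrow> \<forall>\<^sub>F j in sequentially. \<forall>x. norm x \<le> r \<longrightarrow> norm (grad (v j) x) \<le> e"
    by (rule exhausting_bumps[OF R], blast)
  interpret exhaustion R v by unfold_locales (use v R in auto)
  show ?thesis using near_optimal[OF s W c0 L le e] v(1) by blast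
qed

lemma filterlim_distance_at_left: "filterlim (\<lambda>r. R - r) (at_right 0) (at_left (R::real))"
proof -
  have "((\<lambda>r. R - r) \<longlongrightarrow> R - R) (at_left R)" by (intro tendsto_intros)
  then show ?thesis unfolding filterlim_at
    by (auto simp: eventually_at_left_field intro!: exI[of _ "R - 1"])
qed

lemma Im_nonneg:
  fixes u :: "'a::euclidean_space \<Rightarrow> real"
  assumes "Cc_infty R u" "R > 0" "real m + 1 \<le> s"
  shows "0 \<le> Im R s m u"
  using hardy_inequality[OF assms, of 1] by simp

text \<open>Relative to X / d the remainder is a bounded factor times d^q (1 - ln (d / R)) with q =
  m + 2 - s, and it tends to 0 because \<open>s < m + 2\<close>. Taking m = 0 covers
  \<open>I0\<close> for 1 \<le> s < 2.\<close>

lemma INF_Xf_quotient: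
  assumes R: "R > 0" and s: "real m + 1 \<le> s" "s < real m + 2"
  shows "(INF u \<in> {u :: 'a::euclidean_space \<Rightarrow> real. Cc_infty R u \<and> u \<noteq> (\<lambda>x. 0)}.
          ereal (Im R s m u / integral (ball 0 R) (\<lambda>x. \<bar>u x\<bar> / dB R x * Xf (dB R x / R)))) = 0"
proof -
  have den: "integral (ball 0 R) (\<lambda>x. \<bar>u x\<bar> / dB R x * Xf (dB R x / R)) =
     (LINT x|lborel. \<bar>u x\<bar> * (Xf ((R - norm x) / R) / (R - norm x)))"
    if "Cc_infty R u" for u :: "'a \<Rightarrow> real"
    using Cc_infty_integrals(2)[OF that R loc_bounded_Xf] by (simp add: dB_def)
  define N where "N = real DIM('a) - 1"
  define q where "q = real m + 2 - s"
  have q: "q > 0" using s by (simp add: q_def)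
  have small: "\<forall>\<^sub>F r in at_left R. N * ((R - r) powr (real m + 1 - s) / (r * R ^ m)) \<le> (0 + e) * (Xf ((R - r) / R) / (R - r))"
    if e: "e > 0" for e
  proof -
    have "((\<lambda>d. d powr q * (1 - ln (d / R))) \<longlongrightarrow> 0) (at_right 0)"
      using q R by real_asymp
    then have l0: "((\<lambda>r. (R - r) powr q * (1 - ln ((R - r) / R))) \<longlongrightarrow> 0) (at_left R)"
      by (rule filterlim_compose[OF _ filterlim_distance_at_left])
    have "((\<lambda>r. N / (r * R ^ m) * ((R - r) powr q * (1 - ln ((R - r) / R)))) \<longlongrightarrow> N / (R * R ^ m) * 0) (at_left R)"
      using R by (intro tendsto_intros l0) auto
    then have "\<forall>\<^sub>F r in at_left R. N / (r * R ^ m) * ((R - r) powr q * (1 - ln ((R - r) / R))) < e"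
      using e by (intro order_tendstoD) auto
    moreover have "\<forall>\<^sub>F r in at_left R. 0 < r \<and> r < R"
      unfolding eventually_at_left_field using R by auto
    ultimately show ?thesis
    proof eventually_elim
      case (elim r)
      have L: "0 < 1 - ln ((R - r) / R)" using log_term_ge_1[of r R] elim by linarith
      have "(R - r) powr q = (R - r) powr (real m + 1 - s) * (R - r)"
        using elim powr_add[of "R - r" "real m + 1 - s" 1] by (simp add: q_def algebra_simps)
      then have "N * ((R - r) powr (real m + 1 - s) / (r * R ^ m)) =
         N / (r * R ^ m) * ((R - r) powr q * (1 - ln ((R - r) / R))) * (Xf ((R - r) / R) / (R - r))"
        using elim L by (simp add: Xf_def)
      also have "\<dots> \<le> e * (Xf ((R - r) / R) / (R - r))"
        using elim Xf_pos[of r R] by (intro mult_right_mono) auto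
      finally show ?case by simp
    qed
  qed
  have "(INF u \<in> {u :: 'a \<Rightarrow> real. Cc_infty R u \<and> u \<noteq> (\<lambda>x. 0)}.
          ereal (Im R s m u / integral (ball 0 R) (\<lambda>x. \<bar>u x\<bar> / dB R x * Xf (dB R x / R)))) = ereal 0"
  proof (rule INF_ereal_eqI)
    fix u :: "'a \<Rightarrow> real" assume "u \<in> {u. Cc_infty R u \<and> u \<noteq> (\<lambda>x. 0)}"
    then have u: "Cc_infty R u" "u \<noteq> (\<lambda>x. 0)" by auto
    have "0 < (LINT x|lborel. \<bar>u x\<bar> * (Xf ((R - norm x) / R) / (R - norm x)))"
      by (rule integral_abs_pos[OF u(1) R u(2) loc_bounded_Xf]) (use Xf_pos in auto)
    then show "0 \<le> Im R s m u / integral (ball 0 R) (\<lambda>x. \<bar>u x\<bar> / dB R x * Xf (dB R x / R))"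
      using Im_nonneg[OF u(1) R s(1)] unfolding den[OF u(1)] by simp
  next
    fix e :: real assume e: "e > 0"
    show "\<exists>u\<in>{u :: 'a \<Rightarrow> real. Cc_infty R u \<and> u \<noteq> (\<lambda>x. 0)}.
       Im R s m u / integral (ball 0 R) (\<lambda>x. \<bar>u x\<bar> / dB R x * Xf (dB R x / R)) \<le> 0 + e"
    proof -
      obtain u :: "'a \<Rightarrow> real" where u: "Cc_infty R u" "u \<noteq> (\<lambda>x. 0)"
        "Im R s m u / (LINT x|lborel. \<bar>u x\<bar> * (Xf ((R - norm x) / R) / (R - norm x))) \<le> 0 + e"
        using near_optimal_exists[where 'a='a, OF R s(1) loc_bounded_Xf zero_less_one _ order_refl small[unfolded N_def] e]
        by auto
      then show ?thesis unfolding den[OF u(1), symmetric] by blast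
    qed
  qed
  then show ?thesis by (simp add: zero_ereal_def)
qed

text \<open>At the critical exponent the lower bound is the nonnegativity of \<open>Im\<close> for
  \<open>Suc m\<close>, available because \<open>m + 2 \<le> s\<close>; at larger exponents it is
  that for \<open>m\<close>. For the upper bound, the ratio of the remainder to the weight has the
  limit \<open>L\<close> at the sphere.\<close>

lemma INF_powr_quotient:
  assumes R: "R > 0" and s: "real m + 2 \<le> s" and \<beta>: "s - real m - 1 \<le> \<beta>"
  shows "(INF u \<in> {u :: 'a::euclidean_space \<Rightarrow> real. Cc_infty R u \<and> u \<noteq> (\<lambda>x. 0)}.
          ereal (Im R s m u / integral (ball 0 R) (\<lambda>x. \<bar>u x\<bar> / dB R x powr \<beta>)))
       = ereal (if \<beta> = s - real m - 1 then (real DIM('a) - 1) / R ^ (m + 1) else 0)"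
proof -
  have den: "integral (ball 0 R) (\<lambda>x. \<bar>u x\<bar> / dB R x powr \<beta>) = (LINT x|lborel. \<bar>u x\<bar> * (R - norm x) powr (- \<beta>))"
    if "Cc_infty R u" for u :: "'a \<Rightarrow> real"
    unfolding divide_dB_powr by (rule Cc_infty_integrals(2)[OF that R loc_bounded_powr])
  define N where "N = real DIM('a) - 1"
  have N: "N \<ge> 0" using DIM_positive[where 'a='a] unfolding N_def by simp
  define L where "L = (if \<beta> = s - real m - 1 then N / R ^ (m + 1) else 0)"
  have L: "L \<ge> 0" using N R by (simp add: L_def)
  have ev: "\<forall>\<^sub>F r in at_left R. 0 < r \<and> r < R"
    unfolding eventually_at_left_field using R by auto
  have "((\<lambda>r. N / (r * R ^ m) * (R - r) powr (\<beta> - (s - real m - 1))) \<longlongrightarrow> L) (at_left R)"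
  proof (cases "\<beta> = s - real m - 1")
    case True
    have "((\<lambda>r. N / (r * R ^ m)) \<longlongrightarrow> N / (R * R ^ m)) (at_left R)"
      using R by (intro tendsto_intros) auto
    moreover have "\<forall>\<^sub>F r in at_left R. N / (r * R ^ m) = N / (r * R ^ m) * (R - r) powr (\<beta> - (s - real m - 1))"
      using ev by eventually_elim (simp add: True)
    ultimately show ?thesis using True by (simp add: L_def tendsto_cong)
  next
    case False
    then have "((\<lambda>d. d powr (\<beta> - (s - real m - 1))) \<longlongrightarrow> 0) (at_right 0)"
      using \<beta> by real_asymp
    then have l0: "((\<lambda>r. (R - r) powr (\<beta> - (s - real m - 1))) \<longlongrightarrow> 0) (at_left R)"
      by (rule filterlim_compose[OF _ filterlim_distance_at_left])
    have "((\<lambda>r. N / (r * R ^ m) * (R - r) powr (\<beta> - (s - real m - 1))) \<longlongrightarrow> N / (R * R ^ m) * 0) (at_left R)"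
      using R by (intro tendsto_intros l0) auto
    then show ?thesis using False by (simp add: L_def)
  qed
  then have small: "\<forall>\<^sub>F r in at_left R. N * ((R - r) powr (real m + 1 - s) / (r * R ^ m)) \<le> (L + e) * (R - r) powr (- \<beta>)"
    if e: "e > 0" for e
  proof -
    assume "((\<lambda>r. N / (r * R ^ m) * (R - r) powr (\<beta> - (s - real m - 1))) \<longlongrightarrow> L) (at_left R)"
    then have "\<forall>\<^sub>F r in at_left R. N / (r * R ^ m) * (R - r) powr (\<beta> - (s - real m - 1)) < L + e"
      using e by (intro order_tendstoD) auto
    with ev show ?thesis
    proof eventually_elim
      case (elim r)
      have "(R - r) powr (real m + 1 - s) = (R - r) powr (\<beta> - (s - real m - 1)) * (R - r) powr (- \<beta>)"
        unfolding powr_add[symmetric] by (simp add: algebra_simps)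
      then have "N * ((R - r) powr (real m + 1 - s) / (r * R ^ m)) =
         N / (r * R ^ m) * (R - r) powr (\<beta> - (s - real m - 1)) * (R - r) powr (- \<beta>)"
        by simp
      also have "\<dots> \<le> (L + e) * (R - r) powr (- \<beta>)"
        using elim by (intro mult_right_mono) auto
      finally show ?case .
    qed
  qed
  \<comment> \<open>With \<beta> \<ge> 1 the factor \<open>d powr (1 - \<beta>)\<close> is at least
    \<open>R powr (1 - \<beta>)\<close>, so the weight dominates a multiple of X / d.\<close>
  have \<beta>1: "\<beta> \<ge> 1" using s \<beta> by simp
  have W: "R powr (1 - \<beta>) * (Xf ((R - r) / R) / (R - r)) \<le> (R - r) powr (- \<beta>)" if r: "0 \<le> r" "r < R" for r
  proof -
    have "R powr (1 - \<beta>) * (Xf ((R - r) / R) / (R - r)) \<le> (R - r) powr (1 - \<beta>) * (1 / (R - r))"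
      using r \<beta>1 Xf_le_1[OF r] Xf_pos[OF r] by (intro mult_mono powr_mono2' divide_right_mono) auto
    also have "\<dots> = (R - r) powr (- \<beta>)" using r by (simp add: powr_diff powr_minus divide_inverse)
    finally show ?thesis .
  qed
  have "(INF u \<in> {u :: 'a \<Rightarrow> real. Cc_infty R u \<and> u \<noteq> (\<lambda>x. 0)}.
          ereal (Im R s m u / integral (ball 0 R) (\<lambda>x. \<bar>u x\<bar> / dB R x powr \<beta>))) = ereal L"
  proof (rule INF_ereal_eqI)
    fix u :: "'a \<Rightarrow> real" assume "u \<in> {u. Cc_infty R u \<and> u \<noteq> (\<lambda>x. 0)}"
    then have u: "Cc_infty R u" "u \<noteq> (\<lambda>x. 0)" by auto
    have pos: "0 < (LINT x|lborel. \<bar>u x\<bar> * (R - norm x) powr (- \<beta>))"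
      by (rule integral_abs_pos[OF u(1) R u(2) loc_bounded_powr]) auto
    have "L * (LINT x|lborel. \<bar>u x\<bar> * (R - norm x) powr (- \<beta>)) \<le> Im R s m u"
    proof (cases "\<beta> = s - real m - 1")
      case True
      have "0 \<le> Im R s (Suc m) u" using s by (intro Im_nonneg u R) auto
      also have "\<dots> = Im R s m u - N / R ^ Suc m * integral (ball 0 R) (\<lambda>x. \<bar>u x\<bar> / dB R x powr \<beta>)"
        unfolding Im_def N_def True by (simp add: algebra_simps)
      finally show ?thesis unfolding den[OF u(1)] using True by (simp add: L_def)
    next
      case False
      then show ?thesis using Im_nonneg[OF u(1) R, of m s] s by (simp add: L_def)
    qed
    then show "L \<le> Im R s m u / integral (ball 0 R) (\<lambda>x. \<bar>u x\<bar> / dB R x powr \<beta>)"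
      unfolding den[OF u(1)] using pos by (simp add: pos_le_divide_eq)
  next
    fix e :: real assume e: "e > 0"
    have c: "R powr (1 - \<beta>) > 0" using R by simp
    have s': "real m + 1 \<le> s" using s by simp
    show "\<exists>u\<in>{u :: 'a \<Rightarrow> real. Cc_infty R u \<and> u \<noteq> (\<lambda>x. 0)}.
       Im R s m u / integral (ball 0 R) (\<lambda>x. \<bar>u x\<bar> / dB R x powr \<beta>) \<le> L + e"
      using near_optimal_exists[where 'a='a, OF R s' loc_bounded_powr c W L small[unfolded N_def] e]
      by (auto simp: den)
  qed
  then show ?thesis unfolding L_def N_def .
qed

theorem theorem5p1:
  fixes R :: real
  assumes dim: "DIM('a::euclidean_space) \<ge> 2" and R: "R > 0"
  shows
   "(\<forall>s \<gamma>. s \<ge> 2 \<and> \<gamma> > 1 \<longrightarrow>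
      (\<exists>C \<ge> \<gamma> - 1. \<forall>u :: 'a \<Rightarrow> real. Cc_infty R u \<longrightarrow>
         integral (ball 0 R) (\<lambda>x. norm (grad u x) / dB R x powr (s - 1))
         \<ge> (s - 1) * integral (ball 0 R) (\<lambda>x. \<bar>u x\<bar> / dB R x powr s)
           + (\<Sum>k=1..nat \<lfloor>s\<rfloor> - 1. (real DIM('a) - 1) / R ^ k
                * integral (ball 0 R) (\<lambda>x. \<bar>u x\<bar> / dB R x powr (s - real k)))
           + C / R powr (s - 1)
             * integral (ball 0 R) (\<lambda>x. \<bar>u x\<bar> / dB R x * Xf (dB R x / R) powr \<gamma>))) \<and>
    (\<forall>s (m::nat) \<beta>. s \<ge> 2 \<and> int m \<le> \<lfloor>s\<rfloor> - 2 \<and> \<beta> \<ge> s - real m - 1 \<longrightarrow>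
      (INF u \<in> {u :: 'a \<Rightarrow> real. Cc_infty R u \<and> u \<noteq> (\<lambda>x. 0)}.
          ereal (Im R s m u / integral (ball 0 R) (\<lambda>x. \<bar>u x\<bar> / dB R x powr \<beta>)))
       = ereal (if \<beta> = s - real m - 1 then (real DIM('a) - 1) / R ^ (m + 1) else 0)) \<and>
    (\<forall>s. s \<ge> 2 \<longrightarrow>
      (INF u \<in> {u :: 'a \<Rightarrow> real. Cc_infty R u \<and> u \<noteq> (\<lambda>x. 0)}.
          ereal (Im R s (nat \<lfloor>s\<rfloor> - 1) u
                 / integral (ball 0 R) (\<lambda>x. \<bar>u x\<bar> / dB R x * Xf (dB R x / R)))) = 0) \<and>
    (\<forall>s \<gamma>. 1 \<le> s \<and> s < 2 \<and> \<gamma> > 1 \<longrightarrow>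
      (\<exists>C \<ge> \<gamma> - 1. \<forall>u :: 'a \<Rightarrow> real. Cc_infty R u \<longrightarrow>
         integral (ball 0 R) (\<lambda>x. norm (grad u x) / dB R x powr (s - 1))
         \<ge> (s - 1) * integral (ball 0 R) (\<lambda>x. \<bar>u x\<bar> / dB R x powr s)
           + C / R powr (s - 1)
             * integral (ball 0 R) (\<lambda>x. \<bar>u x\<bar> / dB R x * Xf (dB R x / R) powr \<gamma>))) \<and>
    (\<forall>s. 1 \<le> s \<and> s < 2 \<longrightarrow>
      (INF u \<in> {u :: 'a \<Rightarrow> real. Cc_infty R u \<and> u \<noteq> (\<lambda>x. 0)}.
          ereal (I0 R s u / integral (ball 0 R) (\<lambda>x. \<bar>u x\<bar> / dB R x * Xf (dB R x / R)))) = 0)"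
proof (intro conjI allI impI)
  fix s \<gamma> :: real assume s: "s \<ge> 2 \<and> \<gamma> > 1"
  \<comment> \<open>As s \<ge> 2, the natural subtraction is not truncated and the condition on
    \<open>m\<close> reads \<lfloor>s\<rfloor> \<le> s.\<close>
  then have "real (nat \<lfloor>s\<rfloor> - 1) + 1 \<le> s" "1 \<le> \<gamma>" by linarith+
  note H = hardy_inequality[OF _ R this]
  show "\<exists>C \<ge> \<gamma> - 1. \<forall>u :: 'a \<Rightarrow> real. Cc_infty R u \<longrightarrow>
         integral (ball 0 R) (\<lambda>x. norm (grad u x) / dB R x powr (s - 1))
         \<ge> (s - 1) * integral (ball 0 R) (\<lambda>x. \<bar>u x\<bar> / dB R x powr s)
           + (\<Sum>k=1..nat \<lfloor>s\<rfloor> - 1. (real DIM('a) - 1) / R ^ k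
                * integral (ball 0 R) (\<lambda>x. \<bar>u x\<bar> / dB R x powr (s - real k)))
           + C / R powr (s - 1)
             * integral (ball 0 R) (\<lambda>x. \<bar>u x\<bar> / dB R x * Xf (dB R x / R) powr \<gamma>)"
    using H unfolding Im_def I0_def by (intro exI[of _ "\<gamma> - 1"]) force
next
  fix s \<beta> :: real and m :: nat assume "s \<ge> 2 \<and> int m \<le> \<lfloor>s\<rfloor> - 2 \<and> \<beta> \<ge> s - real m - 1"
  then show "(INF u \<in> {u :: 'a \<Rightarrow> real. Cc_infty R u \<and> u \<noteq> (\<lambda>x. 0)}.
          ereal (Im R s m u / integral (ball 0 R) (\<lambda>x. \<bar>u x\<bar> / dB R x powr \<beta>)))
       = ereal (if \<beta> = s - real m - 1 then (real DIM('a) - 1) / R ^ (m + 1) else 0)"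
    by (intro INF_powr_quotient R) linarith+
next
  \<comment> \<open>For m = \<lfloor>s\<rfloor> - 1 the two bounds of \<open>INF_Xf_quotient\<close>
    become \<lfloor>s\<rfloor> \<le> s < \<lfloor>s\<rfloor> + 1.\<close>
  fix s :: real assume "s \<ge> 2"
  then show "(INF u \<in> {u :: 'a \<Rightarrow> real. Cc_infty R u \<and> u \<noteq> (\<lambda>x. 0)}.
          ereal (Im R s (nat \<lfloor>s\<rfloor> - 1) u
                 / integral (ball 0 R) (\<lambda>x. \<bar>u x\<bar> / dB R x * Xf (dB R x / R)))) = 0"
    by (intro INF_Xf_quotient R) linarith+
next
  fix s \<gamma> :: real assume s: "1 \<le> s \<and> s < 2 \<and> \<gamma> > 1"
  \<comment> \<open>With m = 0 the sum in \<open>Im\<close> is empty, so the same inequality covers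
    this range of \<open>s\<close>.\<close>
  then have "real 0 + 1 \<le> s" "1 \<le> \<gamma>" by linarith+
  note H = hardy_inequality[OF _ R this]
  show "\<exists>C \<ge> \<gamma> - 1. \<forall>u :: 'a \<Rightarrow> real. Cc_infty R u \<longrightarrow>
         integral (ball 0 R) (\<lambda>x. norm (grad u x) / dB R x powr (s - 1))
         \<ge> (s - 1) * integral (ball 0 R) (\<lambda>x. \<bar>u x\<bar> / dB R x powr s)
           + C / R powr (s - 1)
             * integral (ball 0 R) (\<lambda>x. \<bar>u x\<bar> / dB R x * Xf (dB R x / R) powr \<gamma>)"
    using H unfolding Im_def I0_def by (intro exI[of _ "\<gamma> - 1"]) force
next
  fix s :: real assume "1 \<le> s \<and> s < 2"
  then show "(INF u \<in> {u :: 'a \<Rightarrow> real. Cc_infty R u \<and> u \<noteq> (\<lambda>x. 0)}.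
          ereal (I0 R s u / integral (ball 0 R) (\<lambda>x. \<bar>u x\<bar> / dB R x * Xf (dB R x / R)))) = 0"
    using INF_Xf_quotient[OF R, of 0 s, where 'a='a] by (simp add: Im_def)
qed

end
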